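(* Let $n\in\mathbb{N}\cup\{0\}$, $\tau\in(0,+\infty)$, $x_0\in\mathbb{R}^d$, and let $f:[0,(n+1)\tau]\times\mathbb{R}^d\times\mathbb{R}^d\to\mathbb{R}^d$ satisfy the following assumptions: (A1) $f(t,\cdot,\cdot)\in C(\mathbb{R}^d\times\mathbb{R}^d;\mathbb{R}^d)$ for all $t\in[0,(n+1)\tau]$; (A2) $f(\cdot,x,z)$ is Borel measurable for all $(x,z)\in\mathbb{R}^d\times\mathbb{R}^d$; (A3) there exists $K:[0,(n+1)\tau]\to[0,+\infty)$ such that $K\in L^1([0,(n+1)\tau])$ and for all $(t,x,z)\in[0,(n+1)\tau]\times\mathbb{R}^d\times\mathbb{R}^d$ $$\|f(t,x,z)\|\le K(t)(1+\|x\|)(1+\|z\|);$$ (A4) for every compact set $U\subset\mathbb{R}^d$ there exists $L_U:[0,(n+1)\tau]\to[0,+\infty)$ such that $L_U\in L^1([0,(n+1)\tau])$ and for all $t\in[0,(n+1)\tau]$, $x_1,x_2\in U$, $z\in\mathbb{R}^d$ $$\|f(t,x_1,z)-f(t,x_2,z)\|\le L_U(t)(1+\|z\|)\|x_1-x_2\|.$$ Then there exists a unique absolutely continuous solution $x=x(x_0,f)$ to the delay differential equation $$x'(t)=f(t,x(t),x(t-\tau)),\quad t\in[0,(n+1)\tau],\qquad x(t)=x_0,\quad t\in[-\tau,0),$$ and, with $\phi_j(t):=x(t+j\tau)$ for $t\in[0,\tau]$, it satisfies for $j=0,1,\ldots,n$ $$\sup_{0\le t\le\tau}\|\phi_j(t)\|\le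 K_j,$$ where $K_{-1}:=\|x_0\|$ and, for $j=0,1,\ldots,n$, $$K_j=(1+K_{j-1})\bigl(1+\|K\|_{L^1([j\tau,(j+1)\tau])}\bigr)\exp\Bigl((1+K_{j-1})\|K\|_{L^1([j\tau,(j+1)\tau])}\Bigr).$$ Moreover, if additionally for some $p\in(1,+\infty]$ the function $K$ in (A3) satisfies $K\in L^p([0,(n+1)\tau])$, then for all $j=0,1,\ldots,n$ and $t,s\in[0,\tau]$ $$\|\phi_j(t)-\phi_j(s)\|\le(1+K_{j-1})(1+K_j)\|K\|_{L^p([j\tau,(j+1)\tau])}\,|t-s|^{1-\frac1p}.$$
   Context: $\|\cdot\|$ is the Euclidean norm on $\mathbb{R}^d$. For $p=+\infty$, $1/p:=0$. Solutions are in the Carathéodory sense: a solution is an absolutely continuous function $x:[-\tau,(n+1)\tau]\to\mathbb{R}^d$ with $x(t)=x_0$ for $t\in[-\tau,0]$ and $x'(t)=f(t,x(t),x(t-\tau))$ for almost every $t\in[0,(n+1)\tau]$. Equivalently, putting $\phi_{-1}\equiv x_0$ on $[0,\tau]$, the functions $\phi_j(t)=x(t+j\tau)$, $j=0,\ldots,n$, $t\in[0,\tau]$, solve successively the initial-value problems $\phi_j'(t)=f(t+j\tau,\phi_j(t),\phi_{j-1}(t))$ for almost every $t\in[0,\tau]$, with $\phi_j(0)=\phi_{j-1}(\tau)$. *)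

theory Defs
  imports "HOL-Analysis.Analysis" "HOL-Probability.Essential_Supremum"
begin

text \<open>
  \<open>HOL-Analysis.Radon_Nikodym\<close> has absolute continuity of measures only; this is the usual
  \<open>\<epsilon>\<close>-\<open>\<delta>\<close> notion for functions, over finite families of non-overlapping intervals.
\<close>

definition absolutely_continuous_fun_on ::
    "real set \<Rightarrow> (real \<Rightarrow> 'a::real_normed_vector) \<Rightarrow> bool" where
  "absolutely_continuous_fun_on S g \<longleftrightarrow>
     (\<forall>\<epsilon>>0. \<exists>\<delta>>0. \<forall>(N::nat) a b.
        (\<forall>i<N. a i \<le> b i \<and> {a i..b i} \<subseteq> S) \<longrightarrow>
        disjoint_family_on (\<lambda>i. {a i<..<b i}) {..<N} \<longrightarrow>
        (\<Sum>i<N. b i - a i) < \<delta> \<longrightarrow>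
        (\<Sum>i<N. norm (g (b i) - g (a i))) < \<epsilon>)"

text \<open>
  Exponents range over \<^typ>\<open>ereal\<close>; note that \<open>1 / \<infinity> = 0\<close> holds there. Both notions below are
  meant for \<open>1 \<le> p\<close>, and \<open>Lp_norm p S g\<close> is meaningful only when \<open>Lp_on p S g\<close> holds.
\<close>

definition Lp_on :: "ereal \<Rightarrow> real set \<Rightarrow> (real \<Rightarrow> real) \<Rightarrow> bool" where
  "Lp_on p S g \<longleftrightarrow>
     g \<in> borel_measurable (lebesgue_on S) \<and>
     (if p = \<infinity> then esssup (lebesgue_on S) (\<lambda>t. ereal \<bar>g t\<bar>) < \<infinity>
      else integrable (lebesgue_on S) (\<lambda>t. \<bar>g t\<bar> powr real_of_ereal p))"

definition Lp_norm :: "ereal \<Rightarrow> real set \<Rightarrow> (real \<Rightarrow> real) \<Rightarrow> real" where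
  "Lp_norm p S g =
     (if p = \<infinity> then real_of_ereal (esssup (lebesgue_on S) (\<lambda>t. ereal \<bar>g t\<bar>))
      else (LINT t|lebesgue_on S. \<bar>g t\<bar> powr real_of_ereal p) powr (1 / real_of_ereal p))"

lemma Lp_on_1: "Lp_on 1 S g \<longleftrightarrow> integrable (lebesgue_on S) g"
proof -
  have "integrable (lebesgue_on S) (\<lambda>t. \<bar>g t\<bar>) \<longleftrightarrow> integrable (lebesgue_on S) g"
    if "g \<in> borel_measurable (lebesgue_on S)"
    using integrable_norm_iff[OF that] by simp
  then show ?thesis
    by (auto simp: Lp_on_def powr_one')
qed

lemma Lp_norm_1: "Lp_norm 1 S g = (LINT t|lebesgue_on S. \<bar>g t\<bar>)"
  by (simp add: Lp_norm_def powr_one')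

text \<open>
  Solutions in the sense of Caratheodory on \<open>[-\<tau>, (n + 1) \<tau>]\<close>. The derivative is
  taken within this interval, so that values of \<open>x\<close> outside it are irrelevant.
\<close>

definition dde_solution ::
    "nat \<Rightarrow> real \<Rightarrow> 'a::real_normed_vector \<Rightarrow> (real \<Rightarrow> 'a \<Rightarrow> 'a \<Rightarrow> 'a) \<Rightarrow> (real \<Rightarrow> 'a) \<Rightarrow> bool" where
  "dde_solution n \<tau> x0 f x \<longleftrightarrow>
     absolutely_continuous_fun_on {-\<tau>..(real n + 1) * \<tau>} x \<and>
     (\<forall>t\<in>{-\<tau>..0}. x t = x0) \<and>
     (AE t in lebesgue_on {0..(real n + 1) * \<tau>}.
        (x has_vector_derivative f t (x t) (x (t - \<tau>))) (at t within {-\<tau>..(real n + 1) * \<tau>}))"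

text \<open>
  The constants \<open>K\<^sub>j\<close>, \<open>j = -1, 0, 1, ...\<close>, with the index shifted by one:
  \<open>dde_bound \<tau> x0 K 0\<close> is \<open>K\<^sub>-\<^sub>1\<close> and \<open>dde_bound \<tau> x0 K (Suc j)\<close> is \<open>K\<^sub>j\<close>.
\<close>

primrec dde_bound :: "real \<Rightarrow> 'a::real_normed_vector \<Rightarrow> (real \<Rightarrow> real) \<Rightarrow> nat \<Rightarrow> real" where
  "dde_bound \<tau> x0 K 0 = norm x0"
| "dde_bound \<tau> x0 K (Suc j) =
     (1 + dde_bound \<tau> x0 K j) *
     (1 + Lp_norm 1 {real j * \<tau>..(real j + 1) * \<tau>} K) *
     exp ((1 + dde_bound \<tau> x0 K j) * Lp_norm 1 {real j * \<tau>..(real j + 1) * \<tau>} K)"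

end

theory Submission
  imports Defs
begin

text \<open>
  With the delayed argument \<open>z\<close> frozen, \<open>x' = f (t, x, z (t - \<tau>))\<close> is a Caratheodory equation with
  linear growth in \<open>x\<close>. Composing the right-hand side with the projection onto a ball makes it bounded
  and globally Lipschitz, so that Banach's fixed point theorem applies in a weighted supremum norm;
  Gronwall's inequality keeps the solution inside the ball, where the truncation is invisible.
  Iterating \<open>z \<mapsto> x\<close> determines the solution on one more interval of length \<open>\<tau>\<close> at each step.

  The equation is equivalent to its integral form because absolutely continuous functions are exactly
  the indefinite integrals of their derivatives, which rests on the Lebesgue differentiation theorem
  and on the fundamental theorem of calculus for the Henstock--Kurzweil integral.
\<close>

section \<open>Absolutely continuous functions and indefinite integrals\<close>

text \<open>(A3) bounds the right-hand side by a product in \<open>x\<close> and \<open>z\<close>,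
  which gives no linear estimate for the delay equation as a whole; it becomes linear once
  \<open>z\<close> is a given continuous function, hence bounded on the compact interval. In
  \<open>z\<close> there is only continuity, while (A4) is a Lipschitz condition in
  \<open>x\<close>. So iterates are not compared by an estimate in their delayed arguments: they
  agree on a further interval of length \<tau> because there the delayed arguments already coincide.
  The Lipschitz function of (A4) depends on the compact set, so a radius has to be known before the
  fixed point argument starts; the growth bound supplies it in advance. Since \<open>K\<close> and
  \<open>L\<close> are merely integrable, derivatives exist only almost everywhere: even
  \<open>exp (c * \<Lambda>)\<close>, with \<open>\<Lambda>\<close> the primitive of an integrable
  function, needs the calculus of absolutely continuous functions before it can serve as a weight or
  in Gronwall's inequality.\<close>

text \<open>Only the interiors are disjoint; shared endpoints are invisible to the integral. The sum
  is thus the integral over the union of the interiors, a subset of \<open>T\<close> on which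
  \<open>h\<close> is nonnegative.\<close>

lemma sum_integral_disjoint_le:
  fixes h :: "real \<Rightarrow> real"
  assumes "finite I" and dis: "disjoint_family_on (\<lambda>i. {a i<..<b i}) I"
    and sub: "\<And>i. i \<in> I \<Longrightarrow> {a i<..<b i} \<subseteq> T"
    and h: "h integrable_on T" "\<And>i. i \<in> I \<Longrightarrow> h integrable_on {a i..b i}"
    and nonneg: "\<And>t. t \<in> T \<Longrightarrow> 0 \<le> h t"
  shows "(\<Sum>i\<in>I. integral {a i..b i} h) \<le> integral T h"
proof -
  have "(h has_integral (\<Sum>i\<in>I. integral {a i..b i} h)) (\<Union>i\<in>I. {a i<..<b i})"
  proof (rule has_integral_UN[OF \<open>finite I\<close>])
    show "(h has_integral integral {a i..b i} h) {a i<..<b i}" if "i \<in> I" for i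
      using h(2)[OF that] has_integral_Icc_iff_Ioo by blast
    show "pairwise (\<lambda>i i'. negligible ({a i<..<b i} \<inter> {a i'<..<b i'})) I"
      using dis by (auto simp: pairwise_def disjoint_family_on_def)
  qed
  then show ?thesis
    by (rule has_integral_subset_le[rotated, OF _ integrable_integral[OF h(1)]]) (use sub nonneg in auto)
qed

lemma sum_length_disjoint_le:
  assumes "finite I" "disjoint_family_on (\<lambda>i. {a i<..<b i}) I"
    and "\<And>i. i \<in> I \<Longrightarrow> a i \<le> b i" "\<And>i. i \<in> I \<Longrightarrow> {a i<..<b i} \<subseteq> T" and T: "T \<in> lmeasurable"
  shows "(\<Sum>i\<in>I. b i - a i) \<le> measure lebesgue T"
proof -
  have "(\<Sum>i\<in>I. b i - a i) = (\<Sum>i\<in>I. integral {a i..b i} (\<lambda>_. 1::real))"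
    using assms(3) by (intro sum.cong) auto
  also have "\<dots> \<le> integral T (\<lambda>_. 1)"
    using assms by (intro sum_integral_disjoint_le integrable_on_const) auto
  finally show ?thesis
    using T by (simp add: lmeasure_integral)
qed

text \<open>The definition indexes families by initial segments of the naturals, whereas a tagged
  division is a set of tagged intervals; a bijection with \<open>{..<card I}\<close>
  translates.\<close>

lemma absolutely_continuous_fun_on_finite_family:
  fixes g :: "real \<Rightarrow> 'a::real_normed_vector"
  assumes "absolutely_continuous_fun_on S g" "\<epsilon> > 0"
  shows "\<exists>\<delta>>0. \<forall>(I::'i set) a b. finite I \<longrightarrow> (\<forall>i\<in>I. a i \<le> b i \<and> {a i..b i} \<subseteq> S) \<longrightarrow>
      disjoint_family_on (\<lambda>i. {a i<..<b i}) I \<longrightarrow> (\<Sum>i\<in>I. b i - a i) < \<delta> \<longrightarrow>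
      (\<Sum>i\<in>I. norm (g (b i) - g (a i))) < \<epsilon>"
proof -
  obtain \<delta> where "\<delta> > 0" and \<delta>: "\<And>(N::nat) a b. (\<forall>i<N. a i \<le> b i \<and> {a i..b i} \<subseteq> S) \<Longrightarrow>
        disjoint_family_on (\<lambda>i. {a i<..<b i}) {..<N} \<Longrightarrow>
        (\<Sum>i<N. b i - a i) < \<delta> \<Longrightarrow> (\<Sum>i<N. norm (g (b i) - g (a i))) < \<epsilon>"
    using assms unfolding absolutely_continuous_fun_on_def by blast
  have "(\<Sum>i\<in>I. norm (g (b i) - g (a i))) < \<epsilon>"
    if I: "finite I" "\<And>i. i \<in> I \<Longrightarrow> a i \<le> b i \<and> {a i..b i} \<subseteq> S"
       "disjoint_family_on (\<lambda>i. {a i<..<b i}) I" "(\<Sum>i\<in>I. b i - a i) < \<delta>"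
    for I :: "'i set" and a b
  proof -
    obtain h where h: "bij_betw h {..<card I} I"
      using ex_bij_betw_nat_finite[OF I(1)] by (auto simp: lessThan_atLeast0)
    have hI: "h k \<in> I" if "k < card I" for k
      using h that by (auto simp: bij_betw_def)
    have eq: "(\<Sum>i\<in>I. f i) = (\<Sum>k<card I. f (h k))" for f :: "'i \<Rightarrow> real"
      using sum.reindex_bij_betw[OF h, of f] by simp
    have "disjoint_family_on (\<lambda>k. {a (h k)<..<b (h k)}) {..<card I}"
      unfolding disjoint_family_on_def
    proof (intro ballI impI)
      fix k l assume kl: "k \<in> {..<card I}" "l \<in> {..<card I}" "k \<noteq> l"
      then have "h k \<noteq> h l"
        using h by (auto simp: bij_betw_def inj_on_def)
      then show "{a (h k)<..<b (h k)} \<inter> {a (h l)<..<b (h l)} = {}"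
        using I(3) hI kl unfolding disjoint_family_on_def by blast
    qed
    then show ?thesis
      using \<delta>[of "card I" "\<lambda>k. a (h k)" "\<lambda>k. b (h k)"] I(2,4) hI unfolding eq by simp
  qed
  then show ?thesis
    by (intro exI[of _ \<delta>] conjI \<open>\<delta> > 0\<close> allI impI) (simp only: Ball_def)
qed

text \<open>
  In a fine tagged division, intervals tagged outside \<open>N\<close> satisfy the usual straddle estimate, and those
  tagged in \<open>N\<close> lie in an open set of small measure, where absolute continuity controls the increments.
  This gives the Henstock--Kurzweil integral of \<open>f\<close> without assuming that \<open>f\<close> is integrable.
\<close>

lemma absolutely_continuous_FTC:
  fixes F :: "real \<Rightarrow> 'a::euclidean_space"
  assumes "a \<le> b" and ac: "absolutely_continuous_fun_on {a..b} F" and N: "negligible N"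
    and deriv: "\<And>t. t \<in> {a..b} - N \<Longrightarrow> (F has_vector_derivative f t) (at t within {a..b})"
  shows "(f has_integral F b - F a) {a..b}"
proof -
  \<comment> \<open>Nothing is known about \<open>f\<close> on \<open>N\<close>. With the value
    \<open>0\<close> there, a term of the Riemann sum tagged in \<open>N\<close> vanishes and only
    the increment of \<open>F\<close> remains to be estimated.\<close>
  define g where "g t = (if t \<in> N then 0 else f t)" for t
  have "(g has_integral F b - F a) {a..b}"
    unfolding has_integral_real
  proof (intro allI impI)
    fix e :: real assume "e > 0"
    \<comment> \<open>The straddle errors sum to at most \<open>c * (b - a)\<close>; the summand
      \<open>1\<close> keeps the denominator positive when \<open>a = b\<close>.\<close>
    define c where "c = e / (2 * (b - a + 1))"
    have c: "c > 0" "c * (b - a) < e / 2"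
      using \<open>a \<le> b\<close> \<open>e > 0\<close> by (auto simp: c_def field_simps)
    obtain \<delta> where "\<delta> > 0" and \<delta>:
      "\<forall>(I::(real \<times> real set) set) u v. finite I \<longrightarrow> (\<forall>i\<in>I. u i \<le> v i \<and> {u i..v i} \<subseteq> {a..b}) \<longrightarrow>
        disjoint_family_on (\<lambda>i. {u i<..<v i}) I \<longrightarrow> (\<Sum>i\<in>I. v i - u i) < \<delta> \<longrightarrow>
        (\<Sum>i\<in>I. norm (F (v i) - F (u i))) < e / 2"
      using absolutely_continuous_fun_on_finite_family[OF ac half_gt_zero[OF \<open>e > 0\<close>]] by blast
    obtain W where W: "open W" "N \<subseteq> W" "W - N \<in> lmeasurable" "emeasure lebesgue (W - N) < ennreal \<delta>"
      using sets_lebesgue_outer_open[OF negligible_imp_sets[OF N] \<open>\<delta> > 0\<close>] .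
    have Wm: "W \<in> lmeasurable" "measure lebesgue W < \<delta>"
    proof -
      have "W = (W - N) \<union> N" using W(2) by blast
      moreover have "(W - N) \<union> N \<in> lmeasurable"
        using W(3) N by (intro fmeasurable.Un) (auto simp: negligible_imp_measurable)
      ultimately show "W \<in> lmeasurable" by simp
      then have "measure lebesgue W = measure lebesgue (W - N)"
        by (intro measure_negligible_symdiff[symmetric])
           (use N W(2,3) in \<open>auto intro: negligible_subset\<close>)
      also have "\<dots> < \<delta>"
        using W(3,4) \<open>\<delta> > 0\<close> by (metis emeasure_eq_measure2 ennreal_less_iff measure_nonneg)
      finally show "measure lebesgue W < \<delta>" .
    qed
    have "\<forall>t. \<exists>r>0. (t \<in> N \<longrightarrow> ball t r \<subseteq> W) \<and> (t \<in> {a..b} - N \<longrightarrow>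
        (\<forall>y\<in>{a..b}. norm (y - t) < r \<longrightarrow> norm (F y - F t - (y - t) *\<^sub>R f t) \<le> c * norm (y - t)))"
    proof
      fix t
      show "\<exists>r>0. (t \<in> N \<longrightarrow> ball t r \<subseteq> W) \<and> (t \<in> {a..b} - N \<longrightarrow>
        (\<forall>y\<in>{a..b}. norm (y - t) < r \<longrightarrow> norm (F y - F t - (y - t) *\<^sub>R f t) \<le> c * norm (y - t)))"
      proof (cases "t \<in> N")
        case True
        then show ?thesis
          using W(1,2) open_contains_ball by blast
      next
        case False
        show ?thesis
        proof (cases "t \<in> {a..b}")
          case True
          with False deriv[of t] c show ?thesis
            by (auto simp: has_vector_derivative_def has_derivative_within_alt)
        next
          case outside: False
          then show ?thesis by (intro exI[of _ 1]) (use False in auto)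
        qed
      qed
    qed
    then obtain r where "\<forall>t. r t > 0 \<and> (t \<in> N \<longrightarrow> ball t (r t) \<subseteq> W) \<and> (t \<in> {a..b} - N \<longrightarrow>
        (\<forall>y\<in>{a..b}. norm (y - t) < r t \<longrightarrow> norm (F y - F t - (y - t) *\<^sub>R f t) \<le> c * norm (y - t)))"
      by (rule choice[THEN exE]) blast
    then have r: "\<And>t. r t > 0" "\<And>t. t \<in> N \<Longrightarrow> ball t (r t) \<subseteq> W"
      "\<And>t y. \<lbrakk>t \<in> {a..b} - N; y \<in> {a..b}; norm (y - t) < r t\<rbrakk> \<Longrightarrow>
         norm (F y - F t - (y - t) *\<^sub>R f t) \<le> c * norm (y - t)"
      by blast+
    show "\<exists>\<gamma>. gauge \<gamma> \<and> (\<forall>p. p tagged_division_of {a..b} \<and> \<gamma> fine p \<longrightarrow>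
        norm ((\<Sum>(t, k)\<in>p. measure lborel k *\<^sub>R g t) - (F b - F a)) < e)"
    proof (intro exI[of _ "\<lambda>t. ball t (r t)"] conjI allI impI; (elim conjE)?)
      show "gauge (\<lambda>t. ball t (r t))"
        using r(1) gauge_ball_dependent by blast
      fix p assume p: "p tagged_division_of {a..b}" and fine: "(\<lambda>t. ball t (r t)) fine p"
      note pD = tagged_division_ofD[OF p]
      \<comment> \<open>\<open>Inf\<close> and \<open>Sup\<close> are the endpoints in which the
        telescoping sum of \<open>additive_tagged_division_1\<close> is phrased.\<close>
      define u v where "u i = Inf (snd i)" and "v i = Sup (snd i)" for i :: "real \<times> real set"
      have K: "snd i = {u i..v i} \<and> u i \<le> v i \<and> fst i \<in> {u i..v i} \<and> {u i..v i} \<subseteq> {a..b}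
          \<and> {u i..v i} \<subseteq> ball (fst i) (r (fst i))" if i: "i \<in> p" for i
      proof -
        obtain t k where tk: "i = (t, k)" by force
        obtain x y where xy: "k = {x..y}" using pD(4)[of t k] i tk by auto
        have "t \<in> k" "k \<subseteq> {a..b}" "k \<subseteq> ball t (r t)"
          using pD(2,3)[of t k] i tk fine by (auto simp: fine_def)
        then show ?thesis
          using tk xy by (auto simp: u_def v_def)
      qed
      have dis: "disjoint_family_on (\<lambda>i. {u i<..<v i}) p"
        unfolding disjoint_family_on_def
      proof (intro ballI impI)
        fix i j assume ij: "i \<in> p" "j \<in> p" "i \<noteq> j"
        then have "interior (snd i) \<inter> interior (snd j) = {}"
          using pD(5)[of "fst i" "snd i" "fst j" "snd j"] by simp
        then show "{u i<..<v i} \<inter> {u j<..<v j} = {}"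
          using K[OF ij(1)] K[OF ij(2)] by (simp add: interior_atLeastAtMost_real)
      qed
      define q where "q = {i \<in> p. fst i \<in> N}"
      have fin: "finite p" "finite q" "q \<subseteq> p" using pD(1) by (auto simp: q_def)
      have disq: "disjoint_family_on (\<lambda>i. {u i<..<v i}) q" "disjoint_family_on (\<lambda>i. {u i<..<v i}) (p - q)"
        using dis fin(3) unfolding disjoint_family_on_def by blast+
      let ?D = "\<lambda>i. (v i - u i) *\<^sub>R g (fst i) - (F (v i) - F (u i))"
      have "(\<Sum>i\<in>q. norm (?D i)) = (\<Sum>i\<in>q. norm (F (v i) - F (u i)))"
        by (intro sum.cong) (auto simp: q_def g_def norm_minus_commute)
      also have "\<dots> < e / 2"
      proof (rule \<delta>[rule_format, OF fin(2) _ disq(1)])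
        show "u i \<le> v i \<and> {u i..v i} \<subseteq> {a..b}" if "i \<in> q" for i
          using K that fin by blast
        have "(\<Sum>i\<in>q. v i - u i) \<le> measure lebesgue W"
        proof (rule sum_length_disjoint_le[OF fin(2) disq(1) _ _ Wm(1)])
          show "u i \<le> v i" if "i \<in> q" for i using K that fin by blast
          show "{u i<..<v i} \<subseteq> W" if "i \<in> q" for i
            using K[of i] r(2)[of "fst i"] that
            by (force simp: q_def)
        qed
        with Wm show "(\<Sum>i\<in>q. v i - u i) < \<delta>" by simp
      qed
      finally have 1: "(\<Sum>i\<in>q. norm (?D i)) < e / 2" .
      have "(\<Sum>i\<in>p - q. norm (?D i)) \<le> (\<Sum>i\<in>p - q. c * (v i - u i))"
      proof (rule sum_mono)
        fix i assume i: "i \<in> p - q"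
        define t where "t = fst i"
        have t: "t \<in> {a..b} - N" "u i \<le> t" "t \<le> v i" "u i \<in> {a..b}" "v i \<in> {a..b}"
          "norm (u i - t) < r t" "norm (v i - t) < r t"
          using K[of i] i by (auto simp: q_def t_def dist_real_def subset_iff abs_minus_commute)
        \<comment> \<open>Subtracting the linearisations at both endpoints cancels
          \<open>F t\<close>; as the tag lies between \<open>u i\<close> and \<open>v i\<close>, the
          two distances add up to the length.\<close>
        have "norm (?D i) = norm ((F (u i) - F t - (u i - t) *\<^sub>R f t) - (F (v i) - F t - (v i - t) *\<^sub>R f t))"
          using t by (simp add: g_def algebra_simps flip: t_def)
        also have "\<dots> \<le> c * norm (u i - t) + c * norm (v i - t)"
          by (intro order_trans[OF norm_triangle_ineq4] add_mono r(3) t)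
        also have "\<dots> = c * (v i - u i)"
          using t by (simp add: algebra_simps)
        finally show "norm (?D i) \<le> c * (v i - u i)" .
      qed
      also have "\<dots> \<le> c * (b - a)"
      proof -
        have "(\<Sum>i\<in>p - q. v i - u i) \<le> measure lebesgue {a..b}"
          by (rule sum_length_disjoint_le[OF _ disq(2)])
             (use fin K in \<open>auto dest!: K simp: subset_iff less_imp_le\<close>)
        then show ?thesis
          using c \<open>a \<le> b\<close> by (simp add: mult_left_mono flip: sum_distrib_left)
      qed
      finally have 2: "(\<Sum>i\<in>p - q. norm (?D i)) < e / 2" using c by simp
      have "(\<Sum>(t, k)\<in>p. measure lborel k *\<^sub>R g t) - (F b - F a) = (\<Sum>i\<in>p. ?D i)"
      proof -
        have "(\<Sum>(t, k)\<in>p. measure lborel k *\<^sub>R g t) = (\<Sum>i\<in>p. (v i - u i) *\<^sub>R g (fst i))"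
          using K by (intro sum.cong) (auto simp: split_def)
        moreover have "F b - F a = (\<Sum>i\<in>p. F (v i) - F (u i))"
          using additive_tagged_division_1[OF \<open>a \<le> b\<close> p, of F] by (simp add: split_def u_def v_def)
        ultimately show ?thesis by (simp add: sum_subtractf)
      qed
      also have "norm \<dots> \<le> (\<Sum>i\<in>p. norm (?D i))" by (rule norm_sum)
      also have "\<dots> = (\<Sum>i\<in>p - q. norm (?D i)) + (\<Sum>i\<in>q. norm (?D i))"
        using fin by (intro sum.subset_diff) auto
      also have "\<dots> < e" using 1 2 by simp
      finally show "norm ((\<Sum>(t, k)\<in>p. measure lborel k *\<^sub>R g t) - (F b - F a)) < e" .
    qed
  qed
  then show ?thesis
    by (rule has_integral_spike[OF N, rotated]) (auto simp: g_def)
qed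

text \<open>Cutting \<open>norm (g t)\<close> off at height \<open>m\<close> leaves a bounded part,
  whose integral is at most \<open>m\<close> times the total length, and a remainder whose integral
  over all of \<open>{a..b}\<close> is small for large \<open>m\<close> by dominated
  convergence.\<close>

lemma absolutely_continuous_indefinite_integral:
  fixes g :: "real \<Rightarrow> 'a::euclidean_space"
  assumes g: "g absolutely_integrable_on {a..b}"
  shows "absolutely_continuous_fun_on {a..b} (\<lambda>t. integral {a..t} g)"
  unfolding absolutely_continuous_fun_on_def
proof (intro allI impI)
  fix e :: real assume "e > 0"
  define h where "h t = norm (g t)" for t
  define hm where "hm m t = min (h t) (real m)" for m :: nat and t
  have h: "h absolutely_integrable_on {a..b}"
    unfolding h_def using g by (rule absolutely_integrable_norm[unfolded o_def])
  then have hi: "h integrable_on {a..b}" using set_lebesgue_integral_eq_integral by blast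
  have gint: "g integrable_on {a..b}" using g set_lebesgue_integral_eq_integral by blast
  have hm: "hm m integrable_on {a..b}" for m
    unfolding hm_def
    by (intro set_lebesgue_integral_eq_integral(1) absolutely_integrable_min_1 h absolutely_integrable_continuous_real) auto
  have "(\<lambda>m. integral {a..b} (hm m)) \<longlonglongrightarrow> integral {a..b} h"
  proof (rule dominated_convergence(2)[OF hm hi])
    show "norm (hm m t) \<le> h t" for m t by (simp add: hm_def h_def)
    show "(\<lambda>m. hm m t) \<longlonglongrightarrow> h t" for t
    proof (rule tendsto_eventually)
      obtain m0 where "h t \<le> real m0" using real_arch_simple by blast
      then show "\<forall>\<^sub>F m in sequentially. hm m t = h t"
        by (auto simp: hm_def eventually_sequentially min_def intro!: exI[of _ m0])
    qed
  qed
  then obtain m where m: "norm (integral {a..b} (hm m) - integral {a..b} h) < e / 2"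
    using LIMSEQ_D[of _ _ "e / 2"] \<open>e > 0\<close> by (meson half_gt_zero order_refl)
  \<comment> \<open>Makes the bounded part contribute at most \<open>e / 2\<close>; the summand
    \<open>1\<close> covers \<open>m = 0\<close>.\<close>
  define \<delta> where "\<delta> = e / (2 * (real m + 1))"
  show "\<exists>\<delta>>0. \<forall>(N::nat) u v. (\<forall>i<N. u i \<le> v i \<and> {u i..v i} \<subseteq> {a..b}) \<longrightarrow>
        disjoint_family_on (\<lambda>i. {u i<..<v i}) {..<N} \<longrightarrow> (\<Sum>i<N. v i - u i) < \<delta> \<longrightarrow>
        (\<Sum>i<N. norm (integral {a..v i} g - integral {a..u i} g)) < e"
  proof (intro exI[of _ \<delta>] conjI allI impI)
    show "\<delta> > 0" using \<open>e > 0\<close> by (simp add: \<delta>_def)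
    fix N :: nat and u v :: "nat \<Rightarrow> real"
    assume uv: "\<forall>i<N. u i \<le> v i \<and> {u i..v i} \<subseteq> {a..b}"
      and dis: "disjoint_family_on (\<lambda>i. {u i<..<v i}) {..<N}" and len: "(\<Sum>i<N. v i - u i) < \<delta>"
    have sub: "u i \<le> v i" "a \<le> u i" "v i \<le> b" if "i < N" for i
      using uv that by auto
    have int: "k integrable_on {u i..v i}" if "k integrable_on {a..b}" "i < N" for k :: "real \<Rightarrow> real" and i
      using integrable_subinterval_real[OF that(1)] uv that(2) by blast
    have "(\<Sum>i<N. norm (integral {a..v i} g - integral {a..u i} g))
        \<le> (\<Sum>i<N. integral {u i..v i} (\<lambda>t. h t - hm m t) + real m * (v i - u i))"
    proof (rule sum_mono)
      fix i assume "i \<in> {..<N}"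
      then have i: "i < N" by simp
      have gi: "g integrable_on {a..v i}"
        using integrable_subinterval_real[OF gint] sub[OF i] by auto
      have "integral {a..v i} g - integral {a..u i} g = integral {u i..v i} g"
        using Henstock_Kurzweil_Integration.integral_combine[OF sub(2,1) gi] i by (simp add: algebra_simps)
      also have "norm \<dots> \<le> integral {u i..v i} h"
        using sub[OF i] int[OF hi i] integrable_subinterval_real[OF gi, of "u i" "v i"]
        by (intro integral_norm_bound_integral) (auto simp: h_def)
      also have "\<dots> = integral {u i..v i} (\<lambda>t. h t - hm m t) + integral {u i..v i} (hm m)"
        using int[OF hi i] int[OF hm i] by (simp add: integral_diff)
      also have "integral {u i..v i} (hm m) \<le> integral {u i..v i} (\<lambda>_. real m)"
        using int[OF hm i] by (intro integral_le) (auto simp: hm_def)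
      also have "\<dots> = real m * (v i - u i)" using sub[OF i] by simp
      finally show "norm (integral {a..v i} g - integral {a..u i} g)
          \<le> integral {u i..v i} (\<lambda>t. h t - hm m t) + real m * (v i - u i)" by simp
    qed
    also have "\<dots> = (\<Sum>i<N. integral {u i..v i} (\<lambda>t. h t - hm m t)) + real m * (\<Sum>i<N. v i - u i)"
      by (simp add: sum.distrib sum_distrib_left)
    also have "(\<Sum>i<N. integral {u i..v i} (\<lambda>t. h t - hm m t)) \<le> integral {a..b} (\<lambda>t. h t - hm m t)"
    proof (rule sum_integral_disjoint_le[OF _ dis])
      show "{u i<..<v i} \<subseteq> {a..b}" if "i \<in> {..<N}" for i using sub[of i] that by auto
      show "(\<lambda>t. h t - hm m t) integrable_on {a..b}" by (intro integrable_diff hi hm)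
      then show "(\<lambda>t. h t - hm m t) integrable_on {u i..v i}" if "i \<in> {..<N}" for i
        using int that by blast
    qed (auto simp: hm_def)
    also have "\<dots> < e / 2" using m hi hm by (simp add: integral_diff abs_if split: if_splits)
    also have "real m * (\<Sum>i<N. v i - u i) \<le> real m * \<delta>" using len by (simp add: mult_left_mono)
    also have "\<dots> \<le> e / 2" using \<open>e > 0\<close> by (simp add: \<delta>_def field_simps)
    finally show "(\<Sum>i<N. norm (integral {a..v i} g - integral {a..u i} g)) < e" by simp
  qed
qed

text \<open>
  Intervals over which the difference quotient stays \<open>1 / (k + 1)\<close> away from \<open>f t\<close> cover the exceptional
  set; Henstock's lemma bounds the total length of a disjoint family of them and Vitali's covering
  lemma transfers the bound to the exceptional set.
\<close>

lemma has_vector_derivative_indefinite_integral_AE: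
  fixes f :: "real \<Rightarrow> 'a::euclidean_space"
  assumes f: "f integrable_on {a..b}"
  obtains N where "negligible N" "\<And>t. t \<in> {a..b} - N \<Longrightarrow>
    ((\<lambda>u. integral {a..u} f) has_vector_derivative f t) (at t within {a..b})"
proof -
  define F where "F u = integral {a..u} f" for u
  define E where "E k = {t \<in> {a..b}. \<forall>\<delta>>0. \<exists>u\<in>{a..b}. norm (u - t) < \<delta> \<and>
      norm (u - t) / real (Suc k) < norm (F u - F t - (u - t) *\<^sub>R f t)}" for k
  have "negligible (E k)" for k
    unfolding negligible_outer_le
  proof (intro allI impI)
    fix e :: real assume "e > 0"
    \<comment> \<open>\<open>Suc k\<close> undoes the tolerance in \<open>E k\<close>, and
      \<open>5\<close> pays for the enlargement of the balls in Vitali's lemma.\<close>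
    define \<eta> where "\<eta> = e / (5 * real (Suc k))"
    have "\<eta> > 0" using \<open>e > 0\<close> by (simp add: \<eta>_def)
    obtain \<gamma> where \<gamma>: "gauge \<gamma>" and small: "\<And>p. \<lbrakk>p tagged_partial_division_of cbox a b; \<gamma> fine p\<rbrakk> \<Longrightarrow>
         (\<Sum>(t, K)\<in>p. norm (measure lborel K *\<^sub>R f t - integral K f)) < \<eta>"
      using Henstock_lemma[OF _ \<open>\<eta> > 0\<close>, of f a b] f by auto
    \<comment> \<open>An index is a point of \<open>E k\<close> together with a witness of the bad
      quotient. The tag is an endpoint of its interval, on either side, hence \<open>min\<close> and
      \<open>max\<close>.\<close>
    define J where "J = {i. fst i \<in> E k \<and> snd i \<in> {a..b} \<and> {min (fst i) (snd i)..max (fst i) (snd i)} \<subseteq> \<gamma> (fst i) \<and>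
        norm (snd i - fst i) / real (Suc k) < norm (F (snd i) - F (fst i) - (snd i - fst i) *\<^sub>R f (fst i))}"
    define c r where "c i = (fst i + snd i) / 2" and "r i = \<bar>fst i - snd i\<bar> / 2" for i :: "real \<times> real"
    have cb: "cball (c i) (r i) = {min (fst i) (snd i)..max (fst i) (snd i)}" for i
      by (auto simp: cball_eq_atLeastAtMost c_def r_def abs_if min_def max_def field_simps)
    have len: "measure lborel (cball (c i) (r i)) = 2 * r i" for i
      by (simp add: cball_eq_atLeastAtMost r_def)
    have rJ: "0 < r i \<and> r i \<le> b - a" if "i \<in> J" for i
      using that by (auto simp: J_def E_def r_def)
    have cover: "E k \<subseteq> (\<Union>i\<in>J. cball (c i) (r i))"
    proof
      fix t assume t: "t \<in> E k"
      obtain \<delta> where "\<delta> > 0" "ball t \<delta> \<subseteq> \<gamma> t"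
        using \<gamma> by (meson gauge_def openE)
      moreover obtain u where "u \<in> {a..b}" "norm (u - t) < \<delta>"
          "norm (u - t) / real (Suc k) < norm (F u - F t - (u - t) *\<^sub>R f t)"
        using t \<open>\<delta> > 0\<close> unfolding E_def by blast
      moreover have "{min t u..max t u} \<subseteq> ball t \<delta>"
        using calculation by (auto simp: dist_real_def)
      ultimately have "(t, u) \<in> J" using t by (auto simp: J_def)
      then show "t \<in> (\<Union>i\<in>J. cball (c i) (r i))"
        by (rule UN_I) (simp add: cb)
    qed
    obtain C where C: "countable C" "C \<subseteq> J"
      "pairwise (\<lambda>i j. disjnt (cball (c i) (r i)) (cball (c j) (r j))) C"
      "E k \<subseteq> (\<Union>i\<in>C. cball (c i) (5 * r i))"
      using Vitali_covering_lemma_cballs[OF cover rJ] by blast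
    \<comment> \<open>Henstock's lemma speaks of finite families, while Vitali's subfamily
      \<open>C\<close> is only countable. A bound uniform over finite subfamilies is enough, since
      it passes to the measure of the countable union.\<close>
    have bound: "(\<Sum>i\<in>D. 2 * r i) \<le> e / 5" if D: "D \<subseteq> C" "finite D" for D
    proof -
      define g where "g i = (fst i, cball (c i) (r i))" for i
      have DJ: "D \<subseteq> J" using D C by blast
      have dj: "cball (c i) (r i) \<inter> cball (c j) (r j) = {}" if "i \<in> D" "j \<in> D" "i \<noteq> j" for i j
        using C(3) D that by (auto simp: pairwise_def disjnt_def)
      have inj: "inj_on g D"
      proof (rule inj_onI)
        fix i j assume ij: "i \<in> D" "j \<in> D" "g i = g j"
        then have "cball (c i) (r i) \<inter> cball (c j) (r j) \<noteq> {}"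
          using rJ[of i] DJ by (auto simp: g_def)
        then show "i = j" using dj ij by blast
      qed
      have sub: "cball (c i) (r i) \<subseteq> {a..b}" if "i \<in> J" for i
        using that by (auto simp: cb J_def E_def)
      have "g ` D tagged_partial_division_of cbox a b"
        unfolding tagged_partial_division_of_def
      proof (intro conjI allI impI)
        fix x K assume "(x, K) \<in> g ` D"
        then obtain i where i: "i \<in> D" "x = fst i" "K = cball (c i) (r i)"
          by (auto simp: g_def)
        show "x \<in> K" "K \<subseteq> cbox a b" "\<exists>a b. K = cbox a b"
          using i sub[of i] DJ by (auto simp: cb)
      next
        fix x1 K1 x2 K2
        assume "(x1, K1) \<in> g ` D \<and> (x2, K2) \<in> g ` D \<and> (x1, K1) \<noteq> (x2, K2)"
        then obtain i j where "i \<in> D" "j \<in> D" "i \<noteq> j" "K1 = cball (c i) (r i)" "K2 = cball (c j) (r j)"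
          by (auto simp: g_def)
        then show "interior K1 \<inter> interior K2 = {}"
          using dj[of i j] interior_subset by blast
      qed (use D in simp)
      moreover have "\<gamma> fine g ` D"
        using DJ by (auto simp: fine_def g_def J_def cb)
      ultimately have "(\<Sum>(t, K)\<in>g ` D. norm (measure lborel K *\<^sub>R f t - integral K f)) < \<eta>"
        by (rule small)
      then have "(\<Sum>i\<in>D. norm ((2 * r i) *\<^sub>R f (fst i) - integral (cball (c i) (r i)) f)) < \<eta>"
        by (subst (asm) sum.reindex[OF inj]) (simp add: g_def len)
      \<comment> \<open>The defining inequality of \<open>J\<close> again: \<open>2 * r i\<close> is
        the distance of the two points, and the integral over the ball is the increment of
        \<open>F\<close> up to the sign of \<open>u - t\<close>.\<close>
      moreover have "2 * r i / real (Suc k) \<le> norm ((2 * r i) *\<^sub>R f (fst i) - integral (cball (c i) (r i)) f)"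
        if "i \<in> D" for i
      proof -
        obtain t u where i: "i = (t, u)" by force
        have tu: "t \<in> {a..b}" "u \<in> {a..b}" "norm (u - t) / real (Suc k) < norm (F u - F t - (u - t) *\<^sub>R f t)"
          using that DJ by (auto simp: i J_def E_def)
        have diff: "F y - F x = integral {x..y} f" if "x \<le> y" "x \<in> {a..b}" "y \<in> {a..b}" for x y
        proof -
          have "f integrable_on {a..y}" using integrable_subinterval_real[OF f, of a y] that by auto
          then show ?thesis
            using Henstock_Kurzweil_Integration.integral_combine[of a x y f] that
            by (simp add: F_def algebra_simps)
        qed
        show ?thesis
        proof (cases "t \<le> u")
          case True
          then have eq: "cball (c i) (r i) = {t..u}" "2 * r i = u - t"
            by (simp_all add: cb i) (simp add: r_def)
          show ?thesis
            unfolding eq using True tu diff[of t u] by (simp add: i norm_minus_commute)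
        next
          case False
          have "F u - F t - (u - t) *\<^sub>R f t = (t - u) *\<^sub>R f t - integral {u..t} f"
            using False tu diff[of u t] by (simp add: algebra_simps)
          moreover have eq: "cball (c i) (r i) = {u..t}" "2 * r i = t - u"
            using False by (simp_all add: cb i) (simp add: r_def)
          ultimately show ?thesis
            unfolding eq using False tu by (simp add: i)
        qed
      qed
      ultimately have "(\<Sum>i\<in>D. 2 * r i / real (Suc k)) \<le> \<eta>"
        by (meson less_imp_le order_trans sum_mono)
      then have "(\<Sum>i\<in>D. 2 * r i) / real (Suc k) \<le> (e / 5) / real (Suc k)"
        by (simp add: \<eta>_def sum_divide_distrib)
      then show ?thesis
        by (simp only: divide_le_cancel)
    qed
    define T where "T = (\<Union>i\<in>C. cball (c i) (5 * r i))"
    have fm: "measure lebesgue (\<Union>i\<in>D. cball (c i) (5 * r i)) \<le> e" if D: "D \<subseteq> C" "finite D" for D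
    proof -
      have "measure lebesgue (\<Union>i\<in>D. cball (c i) (5 * r i)) \<le> (\<Sum>i\<in>D. measure lebesgue (cball (c i) (5 * r i)))"
        by (intro measure_UNION_le D) auto
      also have "\<dots> = (\<Sum>i\<in>D. 5 * (2 * r i))"
        using D C rJ by (intro sum.cong) (auto simp: cball_eq_atLeastAtMost subset_iff less_imp_le)
      also have "\<dots> \<le> e" using bound[OF D] by (simp flip: sum_distrib_left)
      finally show ?thesis .
    qed
    have "T \<in> lmeasurable" "measure lebesgue T \<le> e"
      unfolding T_def using fmeasurable_UN_bound[OF C(1) _ fm] measure_UN_bound[OF C(1) _ fm] by auto
    then show "\<exists>T. E k \<subseteq> T \<and> T \<in> lmeasurable \<and> measure lebesgue T \<le> e"
      using C(4) unfolding T_def by blast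
  qed
  then have "negligible (\<Union>k. E k)"
    by (intro negligible_countable_Union) auto
  moreover have "(F has_vector_derivative f t) (at t within {a..b})" if t: "t \<in> {a..b} - (\<Union>k. E k)" for t
    unfolding has_vector_derivative_def has_derivative_within_alt
  proof (intro conjI allI impI)
    fix e :: real assume "e > 0"
    then obtain k where k: "1 / real (Suc k) < e"
      using nat_approx_posE by metis
    have "t \<notin> E k" using t by blast
    then obtain \<delta> where "\<delta> > 0" and \<delta>: "\<And>u. \<lbrakk>u \<in> {a..b}; norm (u - t) < \<delta>\<rbrakk> \<Longrightarrow>
        norm (F u - F t - (u - t) *\<^sub>R f t) \<le> norm (u - t) / real (Suc k)"
      using t unfolding E_def by force
    have "norm (F u - F t - (u - t) *\<^sub>R f t) \<le> e * norm (u - t)" if "u \<in> {a..b}" "norm (u - t) < \<delta>" for u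
      using \<delta>[OF that] mult_right_mono[OF less_imp_le[OF k], of "norm (u - t)"] by simp
    with \<open>\<delta> > 0\<close> show "\<exists>d>0. \<forall>u\<in>{a..b}. norm (u - t) < d \<longrightarrow> norm (F u - F t - (u - t) *\<^sub>R f t) \<le> e * norm (u - t)"
      by blast
  qed (rule bounded_linear_scaleR_left)
  ultimately show thesis
    using that unfolding F_def by blast
qed


section \<open>Lipschitz images of absolutely continuous functions\<close>

text \<open>The Lipschitz bound is asked only at values taken by \<open>g\<close>, which admits
  \<open>exp\<close>: it is Lipschitz on half-lines bounded above, but not globally.\<close>

lemma absolutely_continuous_fun_on_Lipschitz_compose:
  fixes g :: "real \<Rightarrow> 'a::real_normed_vector" and \<phi> :: "'a \<Rightarrow> 'b::real_normed_vector"
  assumes g: "absolutely_continuous_fun_on S g"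
    and lip: "\<And>s t. \<lbrakk>s \<in> S; t \<in> S\<rbrakk> \<Longrightarrow> norm (\<phi> (g s) - \<phi> (g t)) \<le> L * norm (g s - g t)"
  shows "absolutely_continuous_fun_on S (\<lambda>t. \<phi> (g t))"
  unfolding absolutely_continuous_fun_on_def
proof (intro allI impI)
  fix e :: real assume "e > 0"
  then have "e / (\<bar>L\<bar> + 1) > 0" by simp
  then obtain \<delta> where "\<delta> > 0" and \<delta>: "\<forall>(N::nat) a b. (\<forall>i<N. a i \<le> b i \<and> {a i..b i} \<subseteq> S) \<longrightarrow>
        disjoint_family_on (\<lambda>i. {a i<..<b i}) {..<N} \<longrightarrow> (\<Sum>i<N. b i - a i) < \<delta> \<longrightarrow>
        (\<Sum>i<N. norm (g (b i) - g (a i))) < e / (\<bar>L\<bar> + 1)"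
    using g unfolding absolutely_continuous_fun_on_def by blast
  show "\<exists>\<delta>>0. \<forall>(N::nat) a b. (\<forall>i<N. a i \<le> b i \<and> {a i..b i} \<subseteq> S) \<longrightarrow>
        disjoint_family_on (\<lambda>i. {a i<..<b i}) {..<N} \<longrightarrow> (\<Sum>i<N. b i - a i) < \<delta> \<longrightarrow>
        (\<Sum>i<N. norm (\<phi> (g (b i)) - \<phi> (g (a i)))) < e"
  proof (intro exI[of _ \<delta>] conjI allI impI \<open>\<delta> > 0\<close>)
    fix N :: nat and a b :: "nat \<Rightarrow> real"
    assume ab: "\<forall>i<N. a i \<le> b i \<and> {a i..b i} \<subseteq> S"
      and "disjoint_family_on (\<lambda>i. {a i<..<b i}) {..<N}" "(\<Sum>i<N. b i - a i) < \<delta>"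
    with \<delta> have small: "(\<Sum>i<N. norm (g (b i) - g (a i))) < e / (\<bar>L\<bar> + 1)" by blast
    have "(\<Sum>i<N. norm (\<phi> (g (b i)) - \<phi> (g (a i)))) \<le> (\<Sum>i<N. (\<bar>L\<bar> + 1) * norm (g (b i) - g (a i)))"
    proof (rule sum_mono)
      fix i assume "i \<in> {..<N}"
      then have "a i \<le> b i" "{a i..b i} \<subseteq> S" using ab by auto
      then have "a i \<in> S" "b i \<in> S" by auto
      then have "norm (\<phi> (g (b i)) - \<phi> (g (a i))) \<le> L * norm (g (b i) - g (a i))"
        by (rule lip[rotated])
      also have "\<dots> \<le> (\<bar>L\<bar> + 1) * norm (g (b i) - g (a i))"
        by (intro mult_right_mono) auto
      finally show "norm (\<phi> (g (b i)) - \<phi> (g (a i))) \<le> (\<bar>L\<bar> + 1) * norm (g (b i) - g (a i))" .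
    qed
    also have "\<dots> = (\<bar>L\<bar> + 1) * (\<Sum>i<N. norm (g (b i) - g (a i)))" by (simp add: sum_distrib_left)
    also have "\<dots> < (\<bar>L\<bar> + 1) * (e / (\<bar>L\<bar> + 1))"
      using small by (intro mult_strict_left_mono) auto
    also have "\<dots> = e" by simp
    finally show "(\<Sum>i<N. norm (\<phi> (g (b i)) - \<phi> (g (a i)))) < e" .
  qed
qed

lemma exp_diff_le:
  fixes x y B :: real
  assumes "x \<le> B" "y \<le> B"
  shows "\<bar>exp x - exp y\<bar> \<le> exp B * \<bar>x - y\<bar>"
proof -
  have *: "\<bar>exp x - exp y\<bar> \<le> exp B * \<bar>x - y\<bar>" if "y \<le> x" "x \<le> B" for x y :: real
  proof -
    have "exp x - exp y = exp x * (1 - exp (y - x))" by (simp add: algebra_simps flip: exp_add)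
    also have "\<dots> \<le> exp x * (x - y)"
      using exp_ge_add_one_self[of "y - x"] by (intro mult_left_mono) (linarith, simp)
    also have "\<dots> \<le> exp B * (x - y)" using that by (intro mult_right_mono) auto
    finally show ?thesis using that by simp
  qed
  show ?thesis
    using *[of x y] *[of y x] assms by (cases "y \<le> x") (auto simp: abs_minus_commute)
qed

section \<open>Integral inequalities\<close>

text \<open>The chain rule for \<open>exp (c * \<Lambda>)\<close> holds off a null set. Since
  \<open>\<Lambda>\<close> increases, its values up to \<open>t\<close> stay below
  \<open>\<Lambda> t\<close>, where \<open>exp\<close> is Lipschitz, so the composition is
  absolutely continuous and is recovered from its derivative.\<close>

lemma has_integral_exp_primitive:
  fixes M :: "real \<Rightarrow> real"
  assumes M: "M integrable_on {a..b}" and nonneg: "\<And>s. s \<in> {a..b} \<Longrightarrow> 0 \<le> M s"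
    and t: "t \<in> {a..b}" and "0 \<le> c"
  shows "((\<lambda>s. M s * (c * exp (c * integral {a..s} M))) has_integral exp (c * integral {a..t} M) - 1) {a..t}"
proof -
  define \<Lambda> where "\<Lambda> s = integral {a..s} M" for s
  have Mt: "M integrable_on {a..t}"
    using integrable_subinterval_real[OF M] t by auto
  then have "M absolutely_integrable_on {a..t}"
    using nonneg t by (intro nonnegative_absolutely_integrable_1) auto
  then have ac: "absolutely_continuous_fun_on {a..t} \<Lambda>"
    unfolding \<Lambda>_def by (rule absolutely_continuous_indefinite_integral)
  have le: "\<Lambda> s \<le> \<Lambda> t" if "s \<in> {a..t}" for s
    unfolding \<Lambda>_def using that t nonneg Mt
    by (intro integral_subset_le integrable_subinterval_real[OF Mt]) auto
  have "absolutely_continuous_fun_on {a..t} (\<lambda>s. exp (c * \<Lambda> s))"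
  proof (rule absolutely_continuous_fun_on_Lipschitz_compose[OF ac, where L = "exp (c * \<Lambda> t) * c"])
    fix r s assume "r \<in> {a..t}" "s \<in> {a..t}"
    then have "\<bar>exp (c * \<Lambda> r) - exp (c * \<Lambda> s)\<bar> \<le> exp (c * \<Lambda> t) * \<bar>c * \<Lambda> r - c * \<Lambda> s\<bar>"
      using le \<open>0 \<le> c\<close> by (intro exp_diff_le mult_left_mono) auto
    also have "\<bar>c * \<Lambda> r - c * \<Lambda> s\<bar> = c * \<bar>\<Lambda> r - \<Lambda> s\<bar>"
      using \<open>0 \<le> c\<close> by (simp add: abs_mult flip: right_diff_distrib)
    finally show "norm (exp (c * \<Lambda> r) - exp (c * \<Lambda> s)) \<le> exp (c * \<Lambda> t) * c * norm (\<Lambda> r - \<Lambda> s)"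
      by (simp add: mult.assoc)
  qed
  moreover obtain N where N: "negligible N" "\<And>s. s \<in> {a..t} - N \<Longrightarrow>
      (\<Lambda> has_vector_derivative M s) (at s within {a..t})"
    using has_vector_derivative_indefinite_integral_AE[OF Mt] unfolding \<Lambda>_def by blast
  moreover have "((\<lambda>s. exp (c * \<Lambda> s)) has_vector_derivative M s * (c * exp (c * \<Lambda> s))) (at s within {a..t})"
    if "s \<in> {a..t} - N" for s
    using N(2)[OF that] unfolding has_real_derivative_iff_has_vector_derivative[symmetric]
    by (auto intro!: derivative_eq_intros)
  ultimately have "((\<lambda>s. M s * (c * exp (c * \<Lambda> s))) has_integral exp (c * \<Lambda> t) - exp (c * \<Lambda> a)) {a..t}"
    using t by (intro absolutely_continuous_FTC[of a t _ N]) auto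
  then show ?thesis by (simp add: \<Lambda>_def)
qed

text \<open>Nonnegativity upgrades Henstock--Kurzweil integrability to absolute integrability, which
  survives multiplication by a bounded measurable function.\<close>

lemma integrable_mult_continuous:
  fixes M u :: "real \<Rightarrow> real"
  assumes M: "M integrable_on {a..b}" and nonneg: "\<And>s. s \<in> {a..b} \<Longrightarrow> 0 \<le> M s"
    and u: "continuous_on {a..b} u"
  shows "(\<lambda>s. M s * u s) integrable_on {a..b}"
proof -
  have "M absolutely_integrable_on {a..b}"
    using nonneg by (intro nonnegative_absolutely_integrable_1 M) auto
  moreover have "u \<in> borel_measurable (lebesgue_on {a..b})"
    by (rule continuous_imp_measurable_on_sets_lebesgue[OF u]) auto
  moreover have "bounded (u ` {a..b})"
    by (intro compact_imp_bounded compact_continuous_image u) auto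
  ultimately have "(\<lambda>s. u s * M s) absolutely_integrable_on {a..b}"
    by (intro absolutely_integrable_bounded_measurable_product_real) auto
  then show ?thesis
    using set_lebesgue_integral_eq_integral(1) by (simp add: mult.commute)
qed

text \<open>
  A positive maximum \<open>B\<close> of \<open>(u - \<alpha> exp \<Lambda>) exp (- 2 \<Lambda>)\<close> would satisfy \<open>B < B\<close>, because
  integrating \<open>M exp (2 \<Lambda>)\<close> gains a factor \<open>1/2\<close>; no product rule is needed.
\<close>

lemma gronwall:
  fixes M u :: "real \<Rightarrow> real"
  assumes M: "M integrable_on {a..b}" and nonneg: "\<And>s. s \<in> {a..b} \<Longrightarrow> 0 \<le> M s"
    and u: "continuous_on {a..b} u"
    and le: "\<And>t. t \<in> {a..b} \<Longrightarrow> u t \<le> \<alpha> + integral {a..t} (\<lambda>s. M s * u s)"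
    and t: "t \<in> {a..b}"
  shows "u t \<le> \<alpha> * exp (integral {a..t} M)"
proof (rule ccontr)
  assume neg: "\<not> ?thesis"
  define \<Lambda> where "\<Lambda> s = integral {a..s} M" for s
  define v where "v s = u s - \<alpha> * exp (\<Lambda> s)" for s
  have cont\<Lambda>: "continuous_on {a..b} \<Lambda>"
    unfolding \<Lambda>_def by (rule indefinite_integral_continuous_1[OF M])
  have contv: "continuous_on {a..b} v"
    unfolding v_def by (intro continuous_intros u cont\<Lambda>)
  have "\<exists>m\<in>{a..b}. \<forall>s\<in>{a..b}. v s * exp (- (2 * \<Lambda> s)) \<le> v m * exp (- (2 * \<Lambda> m))"
    using t by (intro continuous_attains_sup continuous_intros contv cont\<Lambda>) auto
  then obtain m where m: "m \<in> {a..b}"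
    and max: "\<And>s. s \<in> {a..b} \<Longrightarrow> v s * exp (- (2 * \<Lambda> s)) \<le> v m * exp (- (2 * \<Lambda> m))"
    by blast
  define B where "B = v m * exp (- (2 * \<Lambda> m))"
  have vB: "v s \<le> B * exp (2 * \<Lambda> s)" if "s \<in> {a..b}" for s
    using max[OF that] by (simp add: B_def exp_minus field_simps)
  have "0 < v t * exp (- (2 * \<Lambda> t))" using neg by (simp add: v_def \<Lambda>_def)
  then have "B > 0" using max[OF t] by (simp add: B_def)
  have sub: "{a..m} \<subseteq> {a..b}" using m by auto
  have int: "(\<lambda>s. M s * w s) integrable_on {a..m}" if "continuous_on {a..b} w" for w :: "real \<Rightarrow> real"
    using integrable_mult_continuous[OF M nonneg that] integrable_subinterval_real[OF _ sub] by blast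
  have e1: "integral {a..m} (\<lambda>s. M s * exp (\<Lambda> s)) = exp (\<Lambda> m) - 1"
    using has_integral_exp_primitive[OF M nonneg m, of 1] by (intro integral_unique) (simp add: \<Lambda>_def)
  have e2: "integral {a..m} (\<lambda>s. M s * exp (2 * \<Lambda> s)) = (exp (2 * \<Lambda> m) - 1) / 2"
  proof -
    have "((\<lambda>s. M s * (2 * exp (2 * \<Lambda> s)) / 2) has_integral (exp (2 * \<Lambda> m) - 1) / 2) {a..m}"
      using has_integral_exp_primitive[OF M nonneg m, of 2] by (intro has_integral_divide) (simp add: \<Lambda>_def)
    then show ?thesis by (intro integral_unique) simp
  qed
  \<comment> \<open>By \<open>e1\<close>, \<open>\<alpha> * exp \<Lambda>\<close> satisfies the
    integral inequality with equality; subtracting it removes \<open>\<alpha>\<close> and leaves a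
    homogeneous inequality for \<open>v\<close>.\<close>
  have "v m \<le> \<alpha> + integral {a..m} (\<lambda>s. M s * u s) - \<alpha> * exp (\<Lambda> m)"
    using le[OF m] by (simp add: v_def)
  also have "\<dots> = integral {a..m} (\<lambda>s. M s * u s - \<alpha> * (M s * exp (\<Lambda> s)))"
  proof -
    have "(\<lambda>s. M s * exp (\<Lambda> s)) integrable_on {a..m}"
      by (intro int continuous_intros cont\<Lambda>)
    then have "integral {a..m} (\<lambda>s. M s * u s - \<alpha> * (M s * exp (\<Lambda> s)))
        = integral {a..m} (\<lambda>s. M s * u s) - \<alpha> * (exp (\<Lambda> m) - 1)"
      using int[OF u] by (subst integral_diff) (auto simp: e1 intro: integrable_on_mult_right)
    then show ?thesis by (simp add: algebra_simps)
  qed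
  also have "\<dots> = integral {a..m} (\<lambda>s. M s * v s)"
    by (simp add: v_def algebra_simps)
  also have "\<dots> \<le> integral {a..m} (\<lambda>s. B * (M s * exp (2 * \<Lambda> s)))"
  proof (rule integral_le)
    show "(\<lambda>s. M s * v s) integrable_on {a..m}" by (rule int[OF contv])
    show "(\<lambda>s. B * (M s * exp (2 * \<Lambda> s))) integrable_on {a..m}"
      by (intro integrable_on_mult_right int continuous_intros cont\<Lambda>)
    fix s assume "s \<in> {a..m}"
    then have "s \<in> {a..b}" using sub by blast
    then show "M s * v s \<le> B * (M s * exp (2 * \<Lambda> s))"
      using mult_left_mono[OF vB nonneg] by (simp add: algebra_simps)
  qed
  also have "\<dots> = B * ((exp (2 * \<Lambda> m) - 1) / 2)"
    by (simp add: e2)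
  also have "\<dots> < B * exp (2 * \<Lambda> m)"
  proof (rule mult_strict_left_mono[OF _ \<open>B > 0\<close>])
    have *: "(e - 1) / 2 < e" if "e > 0" for e :: real using that by (simp add: field_simps)
    show "(exp (2 * \<Lambda> m) - 1) / 2 < exp (2 * \<Lambda> m)" by (rule *) simp
  qed
  also have "\<dots> = v m" by (simp add: B_def exp_minus)
  finally show False by simp
qed

section \<open>Hoelder's inequality against the constant one\<close>

text \<open>Young's inequality for \<open>g r / l\<close> and \<open>1\<close> is integrated with a
  free scale \<open>l > 0\<close>, which is chosen afterwards.\<close>

lemma integral_Holder_interval:
  fixes g :: "real \<Rightarrow> real"
  assumes "1 < p" "s \<le> t" and nonneg: "\<And>r. r \<in> {s..t} \<Longrightarrow> 0 \<le> g r"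
    and g: "g integrable_on {s..t}" and gp: "(\<lambda>r. g r powr p) integrable_on {s..t}"
  shows "integral {s..t} g \<le> (integral {s..t} (\<lambda>r. g r powr p)) powr (1 / p) * (t - s) powr (1 - 1 / p)"
proof (cases "s = t")
  case False
  define A where "A = integral {s..t} (\<lambda>r. g r powr p)"
  have "A \<ge> 0" unfolding A_def by (intro integral_nonneg gp) auto
  have h: "t - s > 0" using False \<open>s \<le> t\<close> by simp
  have young: "integral {s..t} g \<le> l * (A / l powr p / p + (t - s) * (1 - 1 / p))" if "l > 0" for l
  proof -
    have "integral {s..t} g \<le> integral {s..t} (\<lambda>r. l * (g r powr p / l powr p / p + (1 - 1 / p)))"
    proof (rule integral_le[OF g])
      show "(\<lambda>r. l * (g r powr p / l powr p / p + (1 - 1 / p))) integrable_on {s..t}"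
        by (intro integrable_on_mult_right integrable_add integrable_on_divide gp) auto
      fix r assume "r \<in> {s..t}"
      then have "g r / l * 1 \<le> (g r / l) powr p / p + 1 powr (p / (p - 1)) / (p / (p - 1))"
        using \<open>1 < p\<close> \<open>l > 0\<close> nonneg by (intro Youngs_inequality) (auto simp: field_simps)
      also have "\<dots> = g r powr p / l powr p / p + (1 - 1 / p)"
        using \<open>1 < p\<close> \<open>l > 0\<close> nonneg[OF \<open>r \<in> {s..t}\<close>] by (simp add: powr_divide diff_divide_distrib)
      finally show "g r \<le> l * (g r powr p / l powr p / p + (1 - 1 / p))"
        using \<open>l > 0\<close> by (simp add: field_simps)
    qed
    also have "\<dots> = l * (A / l powr p / p + (t - s) * (1 - 1 / p))"
    proof -
      have "(\<lambda>r. g r powr p / l powr p / p) integrable_on {s..t}"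
        by (intro integrable_on_divide gp)
      then show ?thesis
        using h unfolding A_def by (simp add: integral_add[OF _ integrable_const_ivl])
    qed
    finally show ?thesis .
  qed
  show ?thesis
  proof (cases "A = 0")
    case True
    have "integral {s..t} g \<le> 0 + e" if "e > 0" for e
    proof -
      \<comment> \<open>For \<open>A = 0\<close> the bound is linear in \<open>l\<close>; this scale
        makes it equal to \<open>e\<close>.\<close>
      define l where "l = e / ((t - s) * (1 - 1 / p))"
      have "(t - s) * (1 - 1 / p) > 0" using h \<open>1 < p\<close> by simp
      then have "l > 0" "l * ((t - s) * (1 - 1 / p)) = e" using \<open>e > 0\<close> by (auto simp: l_def)
      then show ?thesis using young[of l] True by simp
    qed
    then have "integral {s..t} g \<le> 0" by (rule field_le_epsilon)
    also have "0 \<le> A powr (1 / p) * (t - s) powr (1 - 1 / p)" by simp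
    finally show ?thesis by (simp add: A_def)
  next
    case False
    with \<open>A \<ge> 0\<close> have "A > 0" by simp
    \<comment> \<open>The scale at which \<open>(g / l) powr p\<close> has mean one, so that the
      weights \<open>1 / p\<close> and \<open>1 - 1 / p\<close> recombine to
      \<open>t - s\<close>.\<close>
    define l where "l = (A / (t - s)) powr (1 / p)"
    have l: "l > 0" "l powr p = A / (t - s)"
      using \<open>A > 0\<close> h \<open>1 < p\<close> by (auto simp: l_def powr_powr)
    have "integral {s..t} g \<le> l * (A / l powr p / p + (t - s) * (1 - 1 / p))"
      using young l by blast
    also have "A / l powr p / p + (t - s) * (1 - 1 / p) = t - s"
    proof -
      have "A / (A / (t - s)) = t - s" using \<open>A > 0\<close> h by simp
      then show ?thesis unfolding l(2) by (simp only:) (simp add: right_diff_distrib)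
    qed
    also have "l * (t - s) = A powr (1 / p) * (t - s) powr (1 - 1 / p)"
      using \<open>A > 0\<close> h by (simp add: l_def powr_divide powr_diff)
    finally show ?thesis by (simp add: A_def)
  qed
qed simp

section \<open>Caratheodory equations\<close>

text \<open>If \<open>w\<close> takes finitely many values, the composition is measurable piece by
  piece; continuity in the second argument carries this to limits of simple functions.\<close>

lemma borel_measurable_Caratheodory_compose:
  fixes g :: "'a \<Rightarrow> 'b::{metric_space, second_countable_topology} \<Rightarrow> 'c::metric_space"
  assumes cont: "\<And>t. t \<in> space M \<Longrightarrow> continuous_on UNIV (g t)"
    and meas: "\<And>w. (\<lambda>t. g t w) \<in> borel_measurable M"
    and w: "w \<in> borel_measurable M"
  shows "(\<lambda>t. g t (w t)) \<in> borel_measurable M"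
proof -
  obtain S where S: "\<And>i. simple_function M (S i)" "\<And>t. t \<in> space M \<Longrightarrow> (\<lambda>i. S i t) \<longlonglongrightarrow> w t"
    using borel_measurable_implies_sequence_metric[OF w] by blast
  have "(\<lambda>t. g t (S i t)) \<in> borel_measurable M" for i
  proof (rule measurable_compose_countable'[where f = "\<lambda>v t. g t v" and I = "S i ` space M"])
    show "S i \<in> measurable M (count_space (S i ` space M))"
      using simple_functionD[OF S(1)] by (subst measurable_count_space_eq2) auto
    show "countable (S i ` space M)"
      using simple_functionD(1)[OF S(1)] by (rule countable_finite)
  qed (rule meas)
  moreover have "(\<lambda>i. g t (S i t)) \<longlonglongrightarrow> g t (w t)" if "t \<in> space M" for t
    using continuous_on_tendsto_compose[OF cont[OF that] S(2)[OF that]] by simp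
  ultimately show ?thesis
    by (rule borel_measurable_LIMSEQ_metric)
qed

text \<open>Gronwall with constant zero. The Lipschitz bound is asked only along the two functions,
  so a constant valid on a ball containing both of them suffices.\<close>

lemma eq_if_integral_Lipschitz:
  fixes x y p q :: "real \<Rightarrow> 'a::euclidean_space"
  assumes cont: "continuous_on {a..b} x" "continuous_on {a..b} y"
    and int: "p integrable_on {a..b}" "q integrable_on {a..b}"
    and x: "\<And>t. t \<in> {a..b} \<Longrightarrow> x t = c + integral {a..t} p"
    and y: "\<And>t. t \<in> {a..b} \<Longrightarrow> y t = c + integral {a..t} q"
    and L: "L integrable_on {a..b}" "\<And>s. s \<in> {a..b} \<Longrightarrow> 0 \<le> L s"
    and lip: "\<And>s. s \<in> {a..b} \<Longrightarrow> norm (p s - q s) \<le> L s * norm (x s - y s)"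
    and t: "t \<in> {a..b}"
  shows "x t = y t"
proof -
  have cu: "continuous_on {a..b} (\<lambda>s. norm (x s - y s))"
    by (intro continuous_intros cont)
  have "norm (x t - y t) \<le> 0 * exp (integral {a..t} L)"
  proof (rule gronwall[OF L cu _ t])
    fix r assume r: "r \<in> {a..b}"
    have sub: "{a..r} \<subseteq> {a..b}" using r by auto
    have pq: "p integrable_on {a..r}" "q integrable_on {a..r}"
      using int integrable_subinterval_real[OF _ sub] by auto
    have "x r - y r = integral {a..r} (\<lambda>s. p s - q s)"
      using x[OF r] y[OF r] by (simp add: integral_diff[OF pq])
    also have "norm \<dots> \<le> integral {a..r} (\<lambda>s. L s * norm (x s - y s))"
    proof (rule integral_norm_bound_integral)
      show "(\<lambda>s. L s * norm (x s - y s)) integrable_on {a..r}"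
        by (rule integrable_subinterval_real[OF integrable_mult_continuous[OF L cu] sub])
    qed (use pq sub lip in \<open>auto intro: integrable_diff\<close>)
    finally show "norm (x r - y r) \<le> 0 + integral {a..r} (\<lambda>s. L s * norm (x s - y s))" by simp
  qed
  then show ?thesis by simp
qed

text \<open>The summand \<open>1\<close> of the growth bound is integrated over the whole interval
  first, which gives Gronwall a constant \<open>norm c + integral {a..b} M\<close>.\<close>

lemma norm_le_if_linear_growth:
  fixes x p :: "real \<Rightarrow> 'a::euclidean_space"
  assumes cont: "continuous_on {a..b} x" and p: "p integrable_on {a..b}"
    and x: "\<And>t. t \<in> {a..b} \<Longrightarrow> x t = c + integral {a..t} p"
    and M: "M integrable_on {a..b}" "\<And>s. s \<in> {a..b} \<Longrightarrow> 0 \<le> M s"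
    and growth: "\<And>s. s \<in> {a..b} \<Longrightarrow> norm (p s) \<le> M s * (1 + norm (x s))"
    and t: "t \<in> {a..b}"
  shows "norm (x t) \<le> (norm c + integral {a..b} M) * exp (integral {a..b} M)"
proof -
  have cu: "continuous_on {a..b} (\<lambda>s. norm (x s))"
    by (intro continuous_intros cont)
  have mono: "integral {a..r} M \<le> integral {a..b} M" "M integrable_on {a..r}" if "r \<in> {a..b}" for r
  proof -
    show "M integrable_on {a..r}" using integrable_subinterval_real[OF M(1)] that by auto
    then show "integral {a..r} M \<le> integral {a..b} M"
      using that M by (intro integral_subset_le) auto
  qed
  have nn: "0 \<le> integral {a..b} M" using M by (intro integral_nonneg) auto
  have "norm (x t) \<le> (norm c + integral {a..b} M) * exp (integral {a..t} M)"
  proof (rule gronwall[OF M cu _ t])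
    fix r assume r: "r \<in> {a..b}"
    have sub: "{a..r} \<subseteq> {a..b}" using r by auto
    have int: "(\<lambda>s. M s * norm (x s)) integrable_on {a..r}"
      by (rule integrable_subinterval_real[OF integrable_mult_continuous[OF M cu] sub])
    have "norm (integral {a..r} p) \<le> integral {a..r} (\<lambda>s. M s + M s * norm (x s))"
    proof (rule integral_norm_bound_integral)
      show "p integrable_on {a..r}" by (rule integrable_subinterval_real[OF p sub])
      show "(\<lambda>s. M s + M s * norm (x s)) integrable_on {a..r}"
        by (intro integrable_add mono(2) r int)
      show "norm (p s) \<le> M s + M s * norm (x s)" if "s \<in> {a..r}" for s
        using growth[of s] that sub by (auto simp: algebra_simps)
    qed
    also have "\<dots> = integral {a..r} M + integral {a..r} (\<lambda>s. M s * norm (x s))"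
      by (rule integral_add[OF mono(2)[OF r] int])
    finally show "norm (x r) \<le> norm c + integral {a..b} M + integral {a..r} (\<lambda>s. M s * norm (x s))"
      using x[OF r] mono(1)[OF r] norm_triangle_ineq[of c "integral {a..r} p"] by simp
  qed
  also have "\<dots> \<le> (norm c + integral {a..b} M) * exp (integral {a..b} M)"
    using mono(1)[OF t] nn by (intro mult_left_mono) auto
  finally show ?thesis .
qed

section \<open>Existence by contraction\<close>

text \<open>The complete space at hand consists of bounded continuous functions on the whole line;
  extending by the boundary values embeds the functions on \<open>{a..b}\<close>.\<close>

lemma clamp_bcontfun:
  fixes g :: "real \<Rightarrow> 'a::euclidean_space"
  assumes "a \<le> b" and g: "continuous_on {a..b} g"
  shows "(\<lambda>t. g (max a (min b t))) \<in> bcontfun"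
proof -
  have im: "max a (min b t) \<in> {a..b}" for t using \<open>a \<le> b\<close> by auto
  have "continuous_on UNIV (\<lambda>t. g (max a (min b t)))"
    by (rule continuous_on_compose2[OF g]) (use im in \<open>auto intro!: continuous_intros\<close>)
  moreover have "bounded (g ` {a..b})"
    by (intro compact_imp_bounded compact_continuous_image g) auto
  then have "bounded (range (\<lambda>t. g (max a (min b t))))"
    by (rule bounded_subset) (use im in auto)
  ultimately show ?thesis by (simp add: bcontfun_def)
qed

text \<open>
  The Picard operator contracts by \<open>1/2\<close> in the supremum norm weighted by \<open>exp (- 2 * integral {a..t} L)\<close>; the unknown
  below is the weighted function.
\<close>

lemma Caratheodory_exists_global_Lipschitz:
  fixes h :: "real \<Rightarrow> 'a::euclidean_space \<Rightarrow> 'a"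
  assumes "a \<le> b"
    and meas: "\<And>x. continuous_on {a..b} x \<Longrightarrow> (\<lambda>s. h s (x s)) \<in> borel_measurable (lebesgue_on {a..b})"
    and m: "m integrable_on {a..b}" "\<And>s w. s \<in> {a..b} \<Longrightarrow> norm (h s w) \<le> m s"
    and L: "L integrable_on {a..b}" "\<And>s. s \<in> {a..b} \<Longrightarrow> 0 \<le> L s"
    and lip: "\<And>s v w. s \<in> {a..b} \<Longrightarrow> norm (h s v - h s w) \<le> L s * norm (v - w)"
  obtains x where "continuous_on {a..b} x" "(\<lambda>s. h s (x s)) integrable_on {a..b}"
    "\<And>t. t \<in> {a..b} \<Longrightarrow> x t = c + integral {a..t} (\<lambda>s. h s (x s))"
proof -
  define \<Lambda> where "\<Lambda> s = integral {a..s} L" for s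
  define cl where "cl t = max a (min b t)" for t
  define X where "X y s = exp (2 * \<Lambda> s) *\<^sub>R apply_bcontfun y s" for y :: "real \<Rightarrow>\<^sub>C 'a" and s
  define G where "G y t = c + integral {a..t} (\<lambda>s. h s (X y s))" for y t
  define T where "T y t = exp (- (2 * \<Lambda> t)) *\<^sub>R G y t" for y t
  define \<Phi> where "\<Phi> y = Bcontfun (\<lambda>t. T y (cl t))" for y
  have cl: "cl t \<in> {a..b}" and cl_id: "t \<in> {a..b} \<Longrightarrow> cl t = t" for t
    using \<open>a \<le> b\<close> by (auto simp: cl_def)
  have cont\<Lambda>: "continuous_on {a..b} \<Lambda>"
    unfolding \<Lambda>_def by (rule indefinite_integral_continuous_1[OF L(1)])
  have contX: "continuous_on {a..b} (X y)" for y
    unfolding X_def by (intro continuous_intros continuous_on_apply_bcontfun cont\<Lambda>)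
  have int: "(\<lambda>s. h s (x s)) integrable_on {a..b}" if "continuous_on {a..b} x" for x
    using measurable_bounded_by_integrable_imp_absolutely_integrable[OF meas[OF that] _ m(1)] m(2)
    by (auto intro: set_lebesgue_integral_eq_integral(1))
  have contG: "continuous_on {a..b} (G y)" for y
    unfolding G_def by (intro continuous_intros indefinite_integral_continuous_1 int contX)
  have "continuous_on {a..b} (T y)" for y
    unfolding T_def by (intro continuous_intros contG cont\<Lambda>)
  then have "(\<lambda>t. T y (cl t)) \<in> bcontfun" for y
    unfolding cl_def by (rule clamp_bcontfun[OF \<open>a \<le> b\<close>])
  then have \<Phi>: "apply_bcontfun (\<Phi> y) t = T y (cl t)" for y t
    by (simp add: \<Phi>_def Bcontfun_inverse)
  have contraction: "dist (\<Phi> y) (\<Phi> z) \<le> 1 / 2 * dist y z" for y z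
  proof (rule dist_bound)
    fix t
    define u where "u = cl t"
    have u: "u \<in> {a..b}" using cl by (simp add: u_def)
    have sub: "{a..u} \<subseteq> {a..b}" using u by auto
    have iu: "(\<lambda>s. h s (X y s)) integrable_on {a..u}" for y
      using integrable_subinterval_real[OF int[OF contX] sub] .
    \<comment> \<open>The factor \<open>2\<close> completes the derivative of
      \<open>exp (2 * \<Lambda> s)\<close>; the \<open>1 / 2\<close> that compensates for it is the
      contraction constant.\<close>
    have e: "((\<lambda>s. dist y z / 2 * (L s * (2 * exp (2 * \<Lambda> s)))) has_integral
        dist y z / 2 * (exp (2 * \<Lambda> u) - 1)) {a..u}"
      using has_integral_exp_primitive[OF L u, of 2] unfolding \<Lambda>_def
      by (intro has_integral_mult_right) simp
    have "norm (G y u - G z u) = norm (integral {a..u} (\<lambda>s. h s (X y s) - h s (X z s)))"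
      by (simp add: G_def integral_diff[OF iu iu])
    also have "\<dots> \<le> integral {a..u} (\<lambda>s. dist y z / 2 * (L s * (2 * exp (2 * \<Lambda> s))))"
    proof (rule integral_norm_bound_integral)
      show "(\<lambda>s. h s (X y s) - h s (X z s)) integrable_on {a..u}" by (intro integrable_diff iu)
      show "(\<lambda>s. dist y z / 2 * (L s * (2 * exp (2 * \<Lambda> s)))) integrable_on {a..u}"
        using e by blast
      fix s assume "s \<in> {a..u}"
      then have s: "s \<in> {a..b}" using sub by blast
      have "norm (X y s - X z s) = exp (2 * \<Lambda> s) * dist (apply_bcontfun y s) (apply_bcontfun z s)"
        by (simp add: X_def dist_norm flip: scaleR_right_diff_distrib)
      also have "\<dots> \<le> exp (2 * \<Lambda> s) * dist y z"
        by (intro mult_left_mono dist_bounded) auto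
      finally have "L s * norm (X y s - X z s) \<le> L s * (exp (2 * \<Lambda> s) * dist y z)"
        using L(2)[OF s] by (intro mult_left_mono)
      with lip[OF s, of "X y s" "X z s"]
      show "norm (h s (X y s) - h s (X z s)) \<le> dist y z / 2 * (L s * (2 * exp (2 * \<Lambda> s)))"
        by (simp add: algebra_simps)
    qed
    also have "\<dots> = dist y z / 2 * (exp (2 * \<Lambda> u) - 1)"
      using e by (rule integral_unique)
    also have "\<dots> \<le> dist y z / 2 * exp (2 * \<Lambda> u)"
      by (intro mult_left_mono) auto
    finally have le: "norm (G y u - G z u) \<le> dist y z / 2 * exp (2 * \<Lambda> u)" .
    have "dist (apply_bcontfun (\<Phi> y) t) (apply_bcontfun (\<Phi> z) t) = norm (G y u - G z u) / exp (2 * \<Lambda> u)"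
      by (simp add: \<Phi> T_def dist_norm exp_minus divide_inverse mult.commute flip: u_def scaleR_right_diff_distrib)
    also have "\<dots> \<le> 1 / 2 * dist y z"
      using le by (subst pos_divide_le_eq) auto
    finally show "dist (apply_bcontfun (\<Phi> y) t) (apply_bcontfun (\<Phi> z) t) \<le> 1 / 2 * dist y z" .
  qed
  then obtain y where y: "\<Phi> y = y"
    using banach_fix_type[of "1 / 2" \<Phi>] by auto
  show thesis
  proof (rule that[OF contX int[OF contX]])
    fix t assume t: "t \<in> {a..b}"
    have "apply_bcontfun y t = T y t"
      using \<Phi>[of y t] by (simp add: y cl_id[OF t])
    then have "X y t = G y t"
      by (simp add: X_def T_def exp_minus)
    then show "X y t = c + integral {a..t} (\<lambda>s. h s (X y s))"
      by (simp only: G_def)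
  qed
qed

lemma Caratheodory_exists_linear_growth:
  fixes h :: "real \<Rightarrow> 'a::euclidean_space \<Rightarrow> 'a"
  assumes "a \<le> b"
    and meas: "\<And>x. continuous_on {a..b} x \<Longrightarrow> (\<lambda>s. h s (x s)) \<in> borel_measurable (lebesgue_on {a..b})"
    and M: "M integrable_on {a..b}" "\<And>s. s \<in> {a..b} \<Longrightarrow> 0 \<le> M s"
    and growth: "\<And>s w. s \<in> {a..b} \<Longrightarrow> norm (h s w) \<le> M s * (1 + norm w)"
    and lip: "\<And>R. \<exists>L. L integrable_on {a..b} \<and> (\<forall>s\<in>{a..b}. 0 \<le> L s \<and>
        (\<forall>v\<in>cball 0 R. \<forall>w\<in>cball 0 R. norm (h s v - h s w) \<le> L s * norm (v - w)))"
  obtains x where "continuous_on {a..b} x" "(\<lambda>s. h s (x s)) integrable_on {a..b}"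
    "\<And>t. t \<in> {a..b} \<Longrightarrow> x t = c + integral {a..t} (\<lambda>s. h s (x s))"
proof -
  \<comment> \<open>The bound of \<open>norm_le_if_linear_growth\<close>, which depends on
    \<open>c\<close> and \<open>M\<close> only and is therefore available before any solution
    is.\<close>
  define R where "R = (norm c + integral {a..b} M) * exp (integral {a..b} M)"
  have "0 \<le> integral {a..b} M" using M by (intro integral_nonneg) auto
  then have "R \<ge> 0" by (simp add: R_def)
  define P :: "'a \<Rightarrow> 'a" where "P = closest_point (cball 0 R)"
  have ball: "convex (cball (0::'a) R)" "closed (cball (0::'a) R)" "cball (0::'a) R \<noteq> {}"
    using \<open>R \<ge> 0\<close> by auto
  have PR: "P w \<in> cball 0 R" for w
    unfolding P_def by (rule closest_point_in_set[OF ball(2,3)])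
  have P_lip: "norm (P v - P w) \<le> norm (v - w)" for v w
    unfolding P_def using closest_point_lipschitz[OF ball] by (simp add: dist_norm)
  \<comment> \<open>A nonexpansive map fixing the origin does not increase norms, so the truncated
    right-hand side keeps the growth bound with the same \<open>M\<close>, and its solution keeps
    the bound \<open>R\<close>.\<close>
  have "P 0 = 0" unfolding P_def using \<open>R \<ge> 0\<close> by (intro closest_point_self) auto
  then have P_norm: "norm (P w) \<le> norm w" for w
    using P_lip[of w 0] by simp
  obtain L where L: "L integrable_on {a..b}" "\<And>s. s \<in> {a..b} \<Longrightarrow> 0 \<le> L s"
    "\<And>s v w. \<lbrakk>s \<in> {a..b}; v \<in> cball 0 R; w \<in> cball 0 R\<rbrakk> \<Longrightarrow> norm (h s v - h s w) \<le> L s * norm (v - w)"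
    using lip[of R] by blast
  obtain x where x: "continuous_on {a..b} x" "(\<lambda>s. h s (P (x s))) integrable_on {a..b}"
    "\<And>t. t \<in> {a..b} \<Longrightarrow> x t = c + integral {a..t} (\<lambda>s. h s (P (x s)))"
  proof (rule Caratheodory_exists_global_Lipschitz[OF \<open>a \<le> b\<close>, of "\<lambda>s w. h s (P w)" "\<lambda>s. M s * (1 + R)" L c])
    show "(\<lambda>s. h s (P (x s))) \<in> borel_measurable (lebesgue_on {a..b})" if "continuous_on {a..b} x" for x
    proof (rule meas)
      show "continuous_on {a..b} (\<lambda>s. P (x s))"
        unfolding P_def by (rule continuous_on_compose2[OF continuous_on_closest_point[OF ball] that]) auto
    qed
    show "(\<lambda>s. M s * (1 + R)) integrable_on {a..b}"
      using M(1) by (rule integrable_on_mult_left)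
    show "norm (h s (P w)) \<le> M s * (1 + R)" if "s \<in> {a..b}" for s w
      using growth[OF that, of "P w"] PR[of w] M(2)[OF that]
      by (smt (verit, best) mem_cball_0 mult_left_mono)
    show "norm (h s (P v) - h s (P w)) \<le> L s * norm (v - w)" if "s \<in> {a..b}" for s v w
      using L(3)[OF that PR PR, of v w] mult_left_mono[OF P_lip[of v w] L(2)[OF that]] by linarith
  qed (use L in auto)
  have "norm (x t) \<le> R" if "t \<in> {a..b}" for t
    unfolding R_def
  proof (rule norm_le_if_linear_growth[OF x M _ that])
    show "norm (h s (P (x s))) \<le> M s * (1 + norm (x s))" if "s \<in> {a..b}" for s
      using growth[OF that, of "P (x s)"] mult_left_mono[OF P_norm[of "x s"] M(2)[OF that]]
      by (simp add: algebra_simps)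
  qed
  then have Px: "P (x t) = x t" if "t \<in> {a..b}" for t
    unfolding P_def using that by (intro closest_point_self) auto
  show thesis
  proof (rule that[OF x(1)])
    show "(\<lambda>s. h s (x s)) integrable_on {a..b}"
      by (rule integrable_eq[OF x(2)]) (simp add: Px)
    show "x t = c + integral {a..t} (\<lambda>s. h s (x s))" if "t \<in> {a..b}" for t
    proof -
      have "integral {a..t} (\<lambda>s. h s (P (x s))) = integral {a..t} (\<lambda>s. h s (x s))"
        using that by (intro integral_cong) (simp add: Px)
      then show ?thesis using x(3)[OF that] by simp
    qed
  qed
qed

section \<open>Auxiliary facts on absolute continuity, measurability and Lebesgue spaces\<close>

lemma absolutely_continuous_fun_on_subset:
  "\<lbrakk>absolutely_continuous_fun_on S g; T \<subseteq> S\<rbrakk> \<Longrightarrow> absolutely_continuous_fun_on T g"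
  unfolding absolutely_continuous_fun_on_def by (meson subset_trans)

lemma absolutely_continuous_fun_on_imp_continuous_on:
  fixes g :: "real \<Rightarrow> 'a::real_normed_vector"
  assumes g: "absolutely_continuous_fun_on {a..b} g"
  shows "continuous_on {a..b} g"
  unfolding continuous_on_iff
proof (intro ballI allI impI)
  fix x e :: real assume x: "x \<in> {a..b}" and "e > 0"
  then obtain \<delta> where "\<delta> > 0" and \<delta>: "\<forall>(N::nat) u v. (\<forall>i<N. u i \<le> v i \<and> {u i..v i} \<subseteq> {a..b}) \<longrightarrow>
        disjoint_family_on (\<lambda>i. {u i<..<v i}) {..<N} \<longrightarrow> (\<Sum>i<N. v i - u i) < \<delta> \<longrightarrow>
        (\<Sum>i<N. norm (g (v i) - g (u i))) < e"
    using g unfolding absolutely_continuous_fun_on_def by blast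
  have "dist (g y) (g x) < e" if y: "y \<in> {a..b}" "dist y x < \<delta>" for y
    using \<delta>[rule_format, of 1 "\<lambda>_. min x y" "\<lambda>_. max x y"] x y
    by (cases "x \<le> y") (auto simp: disjoint_family_on_def dist_norm norm_minus_commute)
  with \<open>\<delta> > 0\<close> show "\<exists>d>0. \<forall>y\<in>{a..b}. dist y x < d \<longrightarrow> dist (g y) (g x) < e" by blast
qed

lemma continuous_on_Icc_bounded:
  fixes x :: "real \<Rightarrow> 'a::real_normed_vector"
  assumes "continuous_on {a..b} x"
  obtains B where "0 \<le> B" "\<And>t. t \<in> {a..b} \<Longrightarrow> norm (x t) \<le> B"
proof -
  have "bounded (x ` {a..b})"
    by (intro compact_imp_bounded compact_continuous_image assms) auto
  then show thesis
    using that unfolding bounded_pos by (metis imageI less_imp_le)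
qed

lemma borel_measurable_restrict_space_lebesgue_on:
  assumes "g \<in> borel_measurable (restrict_space borel S)"
  shows "g \<in> borel_measurable (lebesgue_on S)"
  by (rule borel_measurable_subalgebra[OF _ _ assms]) (auto simp: sets_restrict_space space_restrict_space)

lemma Lp_on_1_imp_integrable_on:
  assumes "Lp_on 1 S g" "S \<in> sets lebesgue"
  shows "g integrable_on S"
  using assms by (simp add: Lp_on_1 integrable_on_lebesgue_on)

lemma Lp_on_subset:
  assumes S: "Lp_on p S g" and sub: "T \<subseteq> S" and meas: "S \<in> sets lebesgue" "T \<in> sets lebesgue"
  shows "Lp_on p T g"
proof -
  have g: "g \<in> borel_measurable (lebesgue_on S)" using S by (simp add: Lp_on_def)
  then have gT: "g \<in> borel_measurable (lebesgue_on T)" by (rule measurable_restrict_mono[OF _ sub])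
  show ?thesis
  proof (cases "p = \<infinity>")
    case True
    have "AE t in lebesgue_on S. ereal \<bar>g t\<bar> \<le> esssup (lebesgue_on S) (\<lambda>t. ereal \<bar>g t\<bar>)"
      by (rule esssup_AE)
    then have "AE t in lebesgue_on T. ereal \<bar>g t\<bar> \<le> esssup (lebesgue_on S) (\<lambda>t. ereal \<bar>g t\<bar>)"
      using sub meas by (auto simp: AE_restrict_space_iff elim!: eventually_mono)
    then have "esssup (lebesgue_on T) (\<lambda>t. ereal \<bar>g t\<bar>) \<le> esssup (lebesgue_on S) (\<lambda>t. ereal \<bar>g t\<bar>)"
      using gT by (intro esssup_I) auto
    with S gT True show ?thesis by (auto simp: Lp_on_def)
  next
    case False
    have "integrable (lebesgue_on S) (\<lambda>t. \<bar>g t\<bar> powr real_of_ereal p)"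
      using S False by (simp add: Lp_on_def)
    then have "set_integrable lebesgue S (\<lambda>t. \<bar>g t\<bar> powr real_of_ereal p)"
      using meas by (simp add: integrable_restrict_space set_integrable_def)
    then have "set_integrable lebesgue T (\<lambda>t. \<bar>g t\<bar> powr real_of_ereal p)"
      by (rule set_integrable_subset[OF _ meas(2) sub])
    then have "integrable (lebesgue_on T) (\<lambda>t. \<bar>g t\<bar> powr real_of_ereal p)"
      using meas by (simp add: integrable_restrict_space set_integrable_def)
    with gT False show ?thesis by (simp add: Lp_on_def)
  qed
qed

text \<open>For finite \<open>p\<close> this is Hoelder's inequality on \<open>{s..t}\<close>,
  followed by enlarging the domain of the norm to \<open>{a..b}\<close>; for infinite
  \<open>p\<close> it bounds \<open>g\<close> by its essential supremum.\<close>

lemma integral_le_Lp_norm: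
  fixes p :: ereal and g :: "real \<Rightarrow> real"
  assumes "1 < p" and Lp: "Lp_on p {a..b} g" and nonneg: "\<And>r. r \<in> {a..b} \<Longrightarrow> 0 \<le> g r"
    and g: "g integrable_on {a..b}" and st: "a \<le> s" "s \<le> t" "t \<le> b"
  shows "integral {s..t} g \<le> Lp_norm p {a..b} g * (t - s) powr (1 - real_of_ereal (1 / p))"
proof -
  have sub: "{s..t} \<subseteq> {a..b}" using st by auto
  have gst: "g integrable_on {s..t}" by (rule integrable_subinterval_real[OF g sub])
  show ?thesis
  proof (cases p)
    case (real q)
    then have "1 < q" using \<open>1 < p\<close> by simp
    have intl: "integrable (lebesgue_on {a..b}) (\<lambda>r. \<bar>g r\<bar> powr q)"
      using Lp real by (simp add: Lp_on_def)
    have int: "(\<lambda>r. \<bar>g r\<bar> powr q) integrable_on {a..b}"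
      by (rule integrable_on_lebesgue_on[OF intl]) simp
    have norm: "Lp_norm p {a..b} g = (integral {a..b} (\<lambda>r. \<bar>g r\<bar> powr q)) powr (1 / q)"
      using lebesgue_integral_eq_integral[OF intl] real by (simp add: Lp_norm_def)
    have int': "(\<lambda>r. \<bar>g r\<bar> powr q) integrable_on {s..t}"
      by (rule integrable_subinterval_real[OF int sub])
    have abs: "\<bar>g r\<bar> powr q = g r powr q" if "r \<in> {s..t}" for r
      using nonneg[of r] that sub by auto
    have "integral {s..t} g \<le> (integral {s..t} (\<lambda>r. g r powr q)) powr (1 / q) * (t - s) powr (1 - 1 / q)"
      using nonneg sub st gst \<open>1 < q\<close> integrable_eq[OF int' abs] by (intro integral_Holder_interval) auto
    also have "integral {s..t} (\<lambda>r. g r powr q) = integral {s..t} (\<lambda>r. \<bar>g r\<bar> powr q)"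
      using abs by (intro integral_cong) auto
    also have "(integral {s..t} (\<lambda>r. \<bar>g r\<bar> powr q)) powr (1 / q) \<le> (integral {a..b} (\<lambda>r. \<bar>g r\<bar> powr q)) powr (1 / q)"
      using \<open>1 < q\<close> int int' sub
      by (intro powr_mono2 integral_subset_le integral_nonneg) auto
    finally show ?thesis
      using real \<open>1 < q\<close> by (simp add: norm[unfolded real] one_ereal_def mult_right_mono)
  next
    case PInf
    define c where "c = real_of_ereal (esssup (lebesgue_on {a..b}) (\<lambda>t. ereal \<bar>g t\<bar>))"
    have "esssup (lebesgue_on {a..b}) (\<lambda>t. ereal \<bar>g t\<bar>) < \<infinity>"
      using Lp PInf by (simp add: Lp_on_def)
    \<comment> \<open>\<open>real_of_ereal\<close> sends infinite values to \<open>0\<close>. Here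
      the essential supremum is finite: \<open>Lp_on\<close> excludes \<open>\<infinity>\<close>,
      and lying above \<open>\<bar>g r\<bar>\<close> excludes \<open>-\<infinity>\<close>.\<close>
    then have "g r \<le> c" if "ereal \<bar>g r\<bar> \<le> esssup (lebesgue_on {a..b}) (\<lambda>t. ereal \<bar>g t\<bar>)" for r
      using that unfolding c_def by (cases "esssup (lebesgue_on {a..b}) (\<lambda>t. ereal \<bar>g t\<bar>)") auto
    then have "AE r in lebesgue_on {a..b}. g r \<le> c"
      using esssup_AE[of "\<lambda>t. ereal \<bar>g t\<bar>" "lebesgue_on {a..b}"] by (auto elim!: eventually_mono)
    then obtain N where N: "N \<in> null_sets lebesgue" "\<And>r. \<lbrakk>r \<in> {a..b}; r \<notin> N\<rbrakk> \<Longrightarrow> g r \<le> c"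
      by (subst (asm) AE_restrict_space_iff) (auto simp: eventually_ae_filter)
    then have "negligible N" by (simp add: negligible_iff_null_sets)
    \<comment> \<open>Changing \<open>g\<close> on the null set makes the bound \<open>c\<close>
      hold at every point, as the comparison of integrals requires.\<close>
    define h where "h r = (if r \<in> N then c else g r)" for r
    have "(h has_integral integral {s..t} g) {s..t}"
      by (rule has_integral_spike[OF \<open>negligible N\<close> _ integrable_integral[OF gst]]) (simp add: h_def)
    then have "integral {s..t} g \<le> c * (t - s)"
    proof (rule has_integral_le)
      show "((\<lambda>_. c) has_integral c * (t - s)) {s..t}"
        using has_integral_const_real[of c s t] st by (simp add: mult.commute)
      show "h r \<le> c" if "r \<in> {s..t}" for r
        using N(2)[of r] sub that by (auto simp: h_def)
    qed
    then show ?thesis using PInf st by (simp add: Lp_norm_def c_def)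
  qed (use \<open>1 < p\<close> in auto)
qed

section \<open>The delay equation\<close>

text \<open>The right endpoint is a parameter tied to its value by \<open>T_def\<close>, so that the
  product stays folded until it is wanted.\<close>

locale delay_ode =
  fixes n :: nat and \<tau> :: real and x0 :: "'a::euclidean_space"
    and f :: "real \<Rightarrow> 'a \<Rightarrow> 'a \<Rightarrow> 'a" and K :: "real \<Rightarrow> real" and T :: real
  assumes tau_pos: "\<tau> > 0"
    and T_def: "T = (real n + 1) * \<tau>"
    and A1: "\<And>t. t \<in> {0..T} \<Longrightarrow> continuous_on UNIV (\<lambda>(x, z). f t x z)"
    and A2: "\<And>x z. (\<lambda>t. f t x z) \<in> borel_measurable (restrict_space borel {0..T})"
    and K_nonneg: "\<And>t. t \<in> {0..T} \<Longrightarrow> K t \<ge> 0"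
    and K_L1: "Lp_on 1 {0..T} K"
    and A3: "\<And>t x z. t \<in> {0..T} \<Longrightarrow> norm (f t x z) \<le> K t * (1 + norm x) * (1 + norm z)"
    and A4: "\<And>U. compact U \<Longrightarrow>
               \<exists>L :: real \<Rightarrow> real. (\<forall>t\<in>{0..T}. L t \<ge> 0) \<and> Lp_on 1 {0..T} L \<and>
                 (\<forall>t\<in>{0..T}. \<forall>x1\<in>U. \<forall>x2\<in>U. \<forall>z.
                    norm (f t x1 z - f t x2 z) \<le> L t * (1 + norm z) * norm (x1 - x2))"
begin

section \<open>The right-hand side along continuous functions\<close>

lemma T_pos: "T > 0" and mult_tau_le_T: "k \<le> Suc n \<Longrightarrow> real k * \<tau> \<le> T"
  using tau_pos by (auto simp: T_def intro!: mult_right_mono)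

lemma K_integrable: "K integrable_on {0..T}"
  using K_L1 by (rule Lp_on_1_imp_integrable_on) auto

lemma continuous_delayed:
  assumes "continuous_on {-\<tau>..T} z"
  shows "continuous_on {0..T} (\<lambda>s. z (s - \<tau>))"
  by (rule continuous_on_compose2[OF assms]) (use tau_pos in \<open>auto intro!: continuous_intros\<close>)

lemma rhs_measurable:
  assumes x: "continuous_on {0..T} x" and z: "continuous_on {-\<tau>..T} z"
  shows "(\<lambda>s. f s (x s) (z (s - \<tau>))) \<in> borel_measurable (lebesgue_on {0..T})"
proof -
  have "(\<lambda>s. (\<lambda>(x, z). f s x z) (x s, z (s - \<tau>))) \<in> borel_measurable (lebesgue_on {0..T})"
  proof (rule borel_measurable_Caratheodory_compose[where g = "\<lambda>s (x, z). f s x z" and w = "\<lambda>s. (x s, z (s - \<tau>))"])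
    show "continuous_on UNIV (\<lambda>(x, z). f t x z)" if "t \<in> space (lebesgue_on {0..T})" for t
      using that by (intro A1) simp
    show "(\<lambda>t. case w of (x, z) \<Rightarrow> f t x z) \<in> borel_measurable (lebesgue_on {0..T})" for w
      by (cases w) (simp add: borel_measurable_restrict_space_lebesgue_on A2)
    show "(\<lambda>s. (x s, z (s - \<tau>))) \<in> borel_measurable (lebesgue_on {0..T})"
      by (intro continuous_imp_measurable_on_sets_lebesgue continuous_intros x continuous_delayed z) auto
  qed
  then show ?thesis by simp
qed

text \<open>Continuous \<open>x\<close> and \<open>z\<close> are bounded on compact intervals, so a
  multiple of \<open>K\<close> dominates. Absolute integrability is what makes the indefinite
  integral absolutely continuous later.\<close>

lemma rhs_absolutely_integrable:
  assumes x: "continuous_on {0..T} x" and z: "continuous_on {-\<tau>..T} z"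
  shows "(\<lambda>s. f s (x s) (z (s - \<tau>))) absolutely_integrable_on {0..T}"
proof -
  obtain Bx where Bx: "0 \<le> Bx" "\<And>t. t \<in> {0..T} \<Longrightarrow> norm (x t) \<le> Bx"
    using continuous_on_Icc_bounded[OF x] by blast
  obtain Bz where Bz: "0 \<le> Bz" "\<And>t. t \<in> {0..T} \<Longrightarrow> norm (z (t - \<tau>)) \<le> Bz"
    using continuous_on_Icc_bounded[OF continuous_delayed[OF z]] by blast
  show ?thesis
  proof (rule measurable_bounded_by_integrable_imp_absolutely_integrable[OF rhs_measurable[OF x z]])
    show "(\<lambda>s. K s * ((1 + Bx) * (1 + Bz))) integrable_on {0..T}"
      by (intro integrable_on_mult_left K_integrable)
    fix s assume s: "s \<in> {0..T}"
    have "norm (f s (x s) (z (s - \<tau>))) \<le> K s * ((1 + norm (x s)) * (1 + norm (z (s - \<tau>))))"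
      using A3[OF s] by (simp add: mult.assoc)
    also have "\<dots> \<le> K s * ((1 + Bx) * (1 + Bz))"
      using Bx Bz s K_nonneg[OF s] by (intro mult_left_mono mult_mono) auto
    finally show "norm (f s (x s) (z (s - \<tau>))) \<le> K s * ((1 + Bx) * (1 + Bz))" .
  qed auto
qed

lemma rhs_integrable:
  assumes "continuous_on {0..T} x" "continuous_on {-\<tau>..T} z" "0 \<le> a" "b \<le> T"
  shows "(\<lambda>s. f s (x s) (z (s - \<tau>))) integrable_on {a..b}"
  using integrable_subinterval_real[OF set_lebesgue_integral_eq_integral(1)[OF rhs_absolutely_integrable]] assms
  by auto

lemma rhs_Lipschitz:
  obtains L where "L integrable_on {0..T}" "\<And>s. s \<in> {0..T} \<Longrightarrow> 0 \<le> L s"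
    "\<And>s v w z. \<lbrakk>s \<in> {0..T}; v \<in> cball 0 R; w \<in> cball 0 R\<rbrakk>
       \<Longrightarrow> norm (f s v z - f s w z) \<le> L s * (1 + norm z) * norm (v - w)"
proof -
  obtain L where L: "\<forall>t\<in>{0..T}. L t \<ge> 0" "Lp_on 1 {0..T} L"
    "\<forall>t\<in>{0..T}. \<forall>v\<in>cball 0 R. \<forall>w\<in>cball 0 R. \<forall>z.
       norm (f t v z - f t w z) \<le> L t * (1 + norm z) * norm (v - w)"
    using A4[OF compact_cball[of 0 R]] by blast
  show thesis
  proof (rule that)
    show "L integrable_on {0..T}" using L(2) by (rule Lp_on_1_imp_integrable_on) auto
  qed (use L in blast)+
qed

section \<open>The equation with frozen delayed argument\<close>

text \<open>The integral form with the delayed argument \<open>z\<close> decoupled from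
  \<open>x\<close>; \<open>z = x\<close> and \<open>S = T\<close> give back the delay equation. The
  equation is required up to \<open>S\<close> only, but continuity up to \<open>T\<close>, so that
  \<open>x\<close> can itself serve as a delayed argument.\<close>

definition solves_with_delay :: "(real \<Rightarrow> 'a) \<Rightarrow> (real \<Rightarrow> 'a) \<Rightarrow> real \<Rightarrow> bool" where
  "solves_with_delay z x S \<longleftrightarrow> continuous_on {-\<tau>..T} x \<and> (\<forall>t\<in>{-\<tau>..0}. x t = x0) \<and>
     (\<forall>t\<in>{0..S}. x t = x0 + integral {0..t} (\<lambda>s. f s (x s) (z (s - \<tau>))))"

lemma solves_with_delay_exists:
  assumes z: "continuous_on {-\<tau>..T} z"
  shows "\<exists>x. solves_with_delay z x T"
proof -
  obtain Bz where Bz: "0 \<le> Bz" "\<And>t. t \<in> {0..T} \<Longrightarrow> norm (z (t - \<tau>)) \<le> Bz"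
    using continuous_on_Icc_bounded[OF continuous_delayed[OF z]] by blast
  obtain x where x: "continuous_on {0..T} x"
    "\<And>t. t \<in> {0..T} \<Longrightarrow> x t = x0 + integral {0..t} (\<lambda>s. f s (x s) (z (s - \<tau>)))"
  proof (rule Caratheodory_exists_linear_growth[of 0 T "\<lambda>s w. f s w (z (s - \<tau>))" "\<lambda>s. K s * (1 + Bz)" x0])
    show "(\<lambda>s. K s * (1 + Bz)) integrable_on {0..T}"
      by (intro integrable_on_mult_left K_integrable)
    show "0 \<le> K s * (1 + Bz)" if "s \<in> {0..T}" for s
      using K_nonneg[OF that] Bz by simp
    show "norm (f s w (z (s - \<tau>))) \<le> K s * (1 + Bz) * (1 + norm w)" if s: "s \<in> {0..T}" for s w
    proof -
      have "norm (f s w (z (s - \<tau>))) \<le> K s * (1 + norm w) * (1 + norm (z (s - \<tau>)))" by (rule A3[OF s])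
      also have "\<dots> \<le> K s * (1 + norm w) * (1 + Bz)"
        using Bz(2)[OF s] K_nonneg[OF s] by (intro mult_left_mono) auto
      finally show ?thesis by (simp add: ac_simps)
    qed
    show "\<exists>L. L integrable_on {0..T} \<and> (\<forall>s\<in>{0..T}. 0 \<le> L s \<and>
        (\<forall>v\<in>cball 0 R. \<forall>w\<in>cball 0 R. norm (f s v (z (s - \<tau>)) - f s w (z (s - \<tau>))) \<le> L s * norm (v - w)))" for R
    proof -
      obtain L where L: "L integrable_on {0..T}" "\<And>s. s \<in> {0..T} \<Longrightarrow> 0 \<le> L s"
        "\<And>s v w z. \<lbrakk>s \<in> {0..T}; v \<in> cball 0 R; w \<in> cball 0 R\<rbrakk>
           \<Longrightarrow> norm (f s v z - f s w z) \<le> L s * (1 + norm z) * norm (v - w)"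
        using rhs_Lipschitz[of R] by blast
      show ?thesis
      proof (intro exI[of _ "\<lambda>s. L s * (1 + Bz)"] conjI ballI)
        show "(\<lambda>s. L s * (1 + Bz)) integrable_on {0..T}"
          by (intro integrable_on_mult_left L)
        fix s assume s: "s \<in> {0..T}"
        show "0 \<le> L s * (1 + Bz)" using L(2)[OF s] Bz by simp
        fix v w :: 'a assume "v \<in> cball 0 R" "w \<in> cball 0 R"
        then have "norm (f s v (z (s - \<tau>)) - f s w (z (s - \<tau>))) \<le> L s * (1 + norm (z (s - \<tau>))) * norm (v - w)"
          by (rule L(3)[OF s])
        also have "\<dots> \<le> L s * (1 + Bz) * norm (v - w)"
          using Bz(2)[OF s] L(2)[OF s] by (intro mult_right_mono mult_left_mono) auto
        finally show "norm (f s v (z (s - \<tau>)) - f s w (z (s - \<tau>))) \<le> L s * (1 + Bz) * norm (v - w)" .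
      qed
    qed
  qed (use T_pos rhs_measurable[OF _ z] in auto)
  \<comment> \<open>Prepends the constant history; it fits continuously because
    \<open>x 0 = x0\<close>.\<close>
  define y where "y t = x (max 0 t)" for t
  have "continuous_on {-\<tau>..T} y"
    unfolding y_def by (rule continuous_on_compose2[OF x(1)]) (use T_pos in \<open>auto intro!: continuous_intros\<close>)
  moreover have "y t = x0" if "t \<in> {-\<tau>..0}" for t
  proof -
    have "max 0 t = 0" using that by simp
    then show ?thesis using x(2)[of 0] T_pos by (simp add: y_def)
  qed
  moreover have "y t = x0 + integral {0..t} (\<lambda>s. f s (y s) (z (s - \<tau>)))" if "t \<in> {0..T}" for t
  proof -
    have "integral {0..t} (\<lambda>s. f s (y s) (z (s - \<tau>))) = integral {0..t} (\<lambda>s. f s (x s) (z (s - \<tau>)))"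
      by (intro integral_cong) (simp add: y_def)
    then show ?thesis using x(2)[OF that] that by (simp add: y_def)
  qed
  ultimately show ?thesis unfolding solves_with_delay_def by blast
qed

text \<open>Up to time \<open>S\<close> the equation reads the delayed argument only up to
  \<open>S - \<tau>\<close>. Agreement of \<open>z\<close> and \<open>w\<close> there leaves one
  frozen equation, to which the Lipschitz function of a ball containing both solutions applies. Both
  the agreement of iterates and uniqueness for the delay equation rest on this.\<close>

lemma solves_with_delay_unique:
  assumes x: "solves_with_delay z x S" and y: "solves_with_delay w y S"
    and z: "continuous_on {-\<tau>..T} z" and w: "continuous_on {-\<tau>..T} w"
    and eq: "\<And>t. t \<in> {-\<tau>..S - \<tau>} \<Longrightarrow> z t = w t" and "S \<le> T" and t: "t \<in> {-\<tau>..S}"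
  shows "x t = y t"
proof (cases "t \<le> 0")
  case True
  then show ?thesis using x y t by (simp add: solves_with_delay_def)
next
  case False
  have cont: "continuous_on {-\<tau>..T} x" "continuous_on {-\<tau>..T} y"
    using x y by (auto simp: solves_with_delay_def)
  then have cont0: "continuous_on {0..T} x" "continuous_on {0..T} y"
    using tau_pos by (auto elim: continuous_on_subset)
  obtain Bx where Bx: "\<And>t. t \<in> {0..T} \<Longrightarrow> norm (x t) \<le> Bx"
    using continuous_on_Icc_bounded[OF cont0(1)] by blast
  obtain By where By: "\<And>t. t \<in> {0..T} \<Longrightarrow> norm (y t) \<le> By"
    using continuous_on_Icc_bounded[OF cont0(2)] by blast
  obtain Bz where Bz: "0 \<le> Bz" "\<And>t. t \<in> {0..T} \<Longrightarrow> norm (z (t - \<tau>)) \<le> Bz"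
    using continuous_on_Icc_bounded[OF continuous_delayed[OF z]] by blast
  obtain L where L: "L integrable_on {0..T}" "\<And>s. s \<in> {0..T} \<Longrightarrow> 0 \<le> L s"
    "\<And>s u v z. \<lbrakk>s \<in> {0..T}; u \<in> cball 0 (max Bx By); v \<in> cball 0 (max Bx By)\<rbrakk>
       \<Longrightarrow> norm (f s u z - f s v z) \<le> L s * (1 + norm z) * norm (u - v)"
    using rhs_Lipschitz[of "max Bx By"] by blast
  show ?thesis
  proof (rule eq_if_integral_Lipschitz[where a = 0 and b = S and L = "\<lambda>s. L s * (1 + Bz)"])
    show "continuous_on {0..S} x" "continuous_on {0..S} y"
      using cont0 \<open>S \<le> T\<close> by (auto elim: continuous_on_subset)
    show "(\<lambda>s. f s (x s) (z (s - \<tau>))) integrable_on {0..S}"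
      "(\<lambda>s. f s (y s) (w (s - \<tau>))) integrable_on {0..S}"
      using cont0 z w \<open>S \<le> T\<close> by (auto intro: rhs_integrable)
    show "(\<lambda>s. L s * (1 + Bz)) integrable_on {0..S}"
      using integrable_subinterval_real[OF L(1), of 0 S] \<open>S \<le> T\<close> by (intro integrable_on_mult_left) auto
    fix s assume "s \<in> {0..S}"
    then have s: "s \<in> {0..T}" and zw: "w (s - \<tau>) = z (s - \<tau>)" using \<open>S \<le> T\<close> eq by auto
    show "0 \<le> L s * (1 + Bz)" using L(2)[OF s] Bz by simp
    have "norm (f s (x s) (z (s - \<tau>)) - f s (y s) (w (s - \<tau>))) \<le> L s * (1 + norm (z (s - \<tau>))) * norm (x s - y s)"
      unfolding zw by (rule L(3)[OF s]) (use Bx[OF s] By[OF s] in auto)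
    also have "\<dots> \<le> L s * (1 + Bz) * norm (x s - y s)"
      using Bz(2)[OF s] L(2)[OF s] by (intro mult_right_mono mult_left_mono) auto
    finally show "norm (f s (x s) (z (s - \<tau>)) - f s (y s) (w (s - \<tau>))) \<le> L s * (1 + Bz) * norm (x s - y s)" .
  qed (use x y t False in \<open>auto simp: solves_with_delay_def\<close>)
qed

lemma solves_with_delay_mono: "\<lbrakk>solves_with_delay z x S; S' \<le> S\<rbrakk> \<Longrightarrow> solves_with_delay z x S'"
  by (auto simp: solves_with_delay_def)

text \<open>
  Method of steps without gluing: solving on the whole interval with the previous iterate as delayed
  argument, the \<open>k\<close>-th iterate is already correct on \<open>[-\<tau>, k \<tau>]\<close>.
\<close>

lemma self_solution_exists: "\<exists>x. solves_with_delay x x T"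
proof -
  obtain \<Phi> where \<Phi>: "\<And>z. continuous_on {-\<tau>..T} z \<Longrightarrow> solves_with_delay z (\<Phi> z) T"
    using solves_with_delay_exists by metis
  define X where "X k = (\<Phi> ^^ k) (\<lambda>_. x0)" for k
  have X_Suc: "X (Suc k) = \<Phi> (X k)" for k by (simp add: X_def)
  have cont: "continuous_on {-\<tau>..T} (X k)" for k
  proof (induction k)
    case (Suc k)
    then show ?case using \<Phi>[OF Suc] by (simp add: X_Suc solves_with_delay_def)
  qed (simp add: X_def)
  have sol: "solves_with_delay (X k) (X (Suc k)) T" for k
    using \<Phi>[OF cont] by (simp add: X_Suc)
  have agree: "X (Suc k) t = X k t" if "k \<le> Suc n" "t \<in> {-\<tau>..real k * \<tau>}" for k t
    using that
  proof (induction k arbitrary: t)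
    case 0
    then show ?case using sol[of 0] by (auto simp: solves_with_delay_def X_def)
  next
    case (Suc k)
    have T: "real (Suc k) * \<tau> \<le> T" using Suc.prems(1) by (rule mult_tau_le_T)
    show ?case
    proof (rule solves_with_delay_unique[OF _ _ cont cont _ T Suc.prems(2)])
      show "X (Suc k) s = X k s" if "s \<in> {-\<tau>..real (Suc k) * \<tau> - \<tau>}" for s
        using that Suc.prems(1) by (intro Suc.IH) (auto simp: algebra_simps)
    qed (use sol solves_with_delay_mono T in blast)+
  qed
  \<comment> \<open>\<open>X (Suc n)\<close> solves with delayed argument \<open>X n\<close>. The
    two agree up to \<open>n * \<tau> = T - \<tau>\<close>, the last delayed time that the integral
    over \<open>[0, T]\<close> reads.\<close>
  have "solves_with_delay (X (Suc n)) (X (Suc n)) T"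
    unfolding solves_with_delay_def
  proof (intro conjI ballI cont)
    show "X (Suc n) t = x0" if "t \<in> {-\<tau>..0}" for t
      using sol[of n] that by (auto simp: solves_with_delay_def)
    fix t assume t: "t \<in> {0..T}"
    have "integral {0..t} (\<lambda>s. f s (X (Suc n) s) (X n (s - \<tau>)))
        = integral {0..t} (\<lambda>s. f s (X (Suc n) s) (X (Suc n) (s - \<tau>)))"
      using t by (intro integral_cong) (simp add: agree[of n] T_def algebra_simps)
    then show "X (Suc n) t = x0 + integral {0..t} (\<lambda>s. f s (X (Suc n) s) (X (Suc n) (s - \<tau>)))"
      using sol[of n] t by (simp add: solves_with_delay_def)
  qed
  then show ?thesis by blast
qed

lemma self_solution_unique:
  assumes x: "solves_with_delay x x T" and y: "solves_with_delay y y T" and t: "t \<in> {-\<tau>..T}"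
  shows "x t = y t"
proof -
  have cont: "continuous_on {-\<tau>..T} x" "continuous_on {-\<tau>..T} y"
    using x y by (auto simp: solves_with_delay_def)
  have "x t = y t" if "k \<le> Suc n" "t \<in> {-\<tau>..real k * \<tau>}" for k t
    using that
  proof (induction k arbitrary: t)
    case 0
    then show ?case using x y by (auto simp: solves_with_delay_def)
  next
    case (Suc k)
    have T: "real (Suc k) * \<tau> \<le> T" using Suc.prems(1) by (rule mult_tau_le_T)
    show ?case
    proof (rule solves_with_delay_unique[OF _ _ cont _ T Suc.prems(2)])
      show "x s = y s" if "s \<in> {-\<tau>..real (Suc k) * \<tau> - \<tau>}" for s
        using that Suc.prems(1) by (intro Suc.IH) (auto simp: algebra_simps)
    qed (use x y solves_with_delay_mono T in blast)+
  qed
  from this[of "Suc n" t] show ?thesis using t by (simp add: T_def add.commute)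
qed

section \<open>Caratheodory solutions and the integral form\<close>

lemma dde_solution_iff: "dde_solution n \<tau> x0 f x \<longleftrightarrow> solves_with_delay x x T"
proof
  assume sol: "dde_solution n \<tau> x0 f x"
  then have ac: "absolutely_continuous_fun_on {-\<tau>..T} x" and init: "\<And>t. t \<in> {-\<tau>..0} \<Longrightarrow> x t = x0"
    and "AE t in lebesgue_on {0..T}.
        (x has_vector_derivative f t (x t) (x (t - \<tau>))) (at t within {-\<tau>..T})"
    unfolding dde_solution_def T_def by blast+
  then obtain N where N: "N \<in> null_sets lebesgue" "{t \<in> space lebesgue. \<not> (t \<in> {0..T} \<longrightarrow>
        (x has_vector_derivative f t (x t) (x (t - \<tau>))) (at t within {-\<tau>..T}))} \<subseteq> N"
    by (subst (asm) AE_restrict_space_iff) (auto simp: eventually_ae_filter)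
  have "x t = x0 + integral {0..t} (\<lambda>s. f s (x s) (x (s - \<tau>)))" if t: "t \<in> {0..T}" for t
  proof -
    have sub: "{0..t} \<subseteq> {-\<tau>..T}" using t tau_pos by auto
    have "((\<lambda>s. f s (x s) (x (s - \<tau>))) has_integral x t - x 0) {0..t}"
    proof (rule absolutely_continuous_FTC[of 0 t x N])
      show "absolutely_continuous_fun_on {0..t} x"
        by (rule absolutely_continuous_fun_on_subset[OF ac sub])
      show "negligible N" using N(1) by (simp add: negligible_iff_null_sets)
      show "(x has_vector_derivative f s (x s) (x (s - \<tau>))) (at s within {0..t})" if "s \<in> {0..t} - N" for s
      proof (rule has_vector_derivative_within_subset[OF _ sub])
        show "(x has_vector_derivative f s (x s) (x (s - \<tau>))) (at s within {-\<tau>..T})"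
          using N(2) that t by auto
      qed
    qed (use t in auto)
    then show ?thesis using init[of 0] tau_pos by (simp add: integral_unique)
  qed
  with init absolutely_continuous_fun_on_imp_continuous_on[OF ac] show "solves_with_delay x x T"
    by (simp add: solves_with_delay_def)
next
  assume sol: "solves_with_delay x x T"
  then have cont: "continuous_on {-\<tau>..T} x" and init: "\<And>t. t \<in> {-\<tau>..0} \<Longrightarrow> x t = x0"
    and eq: "\<And>t. t \<in> {0..T} \<Longrightarrow> x t = x0 + integral {0..t} (\<lambda>s. f s (x s) (x (s - \<tau>)))"
    by (auto simp: solves_with_delay_def)
  have cont0: "continuous_on {0..T} x"
    using cont tau_pos by (auto elim: continuous_on_subset)
  \<comment> \<open>\<open>dde_solution\<close> asks for absolute continuity and derivatives within
    all of \<open>[-\<tau>, T]\<close>. Extending the right-hand side by zero makes \<open>x\<close>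
    a single indefinite integral there, history included.\<close>
  define g where "g s = (if s \<in> {0..T} then f s (x s) (x (s - \<tau>)) else 0)" for s
  have "(\<lambda>s. if s \<in> {0..T} then f s (x s) (x (s - \<tau>)) else 0) absolutely_integrable_on UNIV"
    using rhs_absolutely_integrable[OF cont0 cont] by (simp only: absolutely_integrable_restrict_UNIV)
  then have g: "g absolutely_integrable_on {-\<tau>..T}"
    unfolding g_def by (rule set_integrable_subset) auto
  then have gi: "g integrable_on {-\<tau>..T}" by (rule set_lebesgue_integral_eq_integral)
  have x_eq: "x t = x0 + integral {-\<tau>..t} g" if t: "t \<in> {-\<tau>..T}" for t
  proof (cases "t \<le> 0")
    case True
    have "integral {-\<tau>..t} g = 0"
    \<comment> \<open>At \<open>0\<close> the extension \<open>g\<close> carries a value of the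
      right-hand side, possibly nonzero, so it vanishes on the history only up to this
      point.\<close>
    proof (rule integral_unique[OF has_integral_spike[of "{0}"]])
      show "((\<lambda>_. 0) has_integral 0) {-\<tau>..t}" by simp
    qed (use True in \<open>auto simp: g_def\<close>)
    then show ?thesis using init[of t] t True by simp
  next
    case False
    have "integral {-\<tau>..0} g = 0"
    proof (rule integral_unique[OF has_integral_spike[of "{0}"]])
      show "((\<lambda>_. 0) has_integral 0) {-\<tau>..0}" by simp
    qed (auto simp: g_def)
    moreover have "integral {0..t} g = integral {0..t} (\<lambda>s. f s (x s) (x (s - \<tau>)))"
      using t by (intro integral_cong) (auto simp: g_def)
    moreover have "g integrable_on {-\<tau>..t}"
      using integrable_subinterval_real[OF gi] t by auto
    ultimately show ?thesis
      using Henstock_Kurzweil_Integration.integral_combine[of "-\<tau>" 0 t g] eq[of t] t False tau_pos by simp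
  qed
  have "absolutely_continuous_fun_on {-\<tau>..T} (\<lambda>t. integral {-\<tau>..t} g)"
    by (rule absolutely_continuous_indefinite_integral[OF g])
  then have ac: "absolutely_continuous_fun_on {-\<tau>..T} (\<lambda>t. x0 + integral {-\<tau>..t} g)"
    by (rule absolutely_continuous_fun_on_Lipschitz_compose[where \<phi> = "\<lambda>w. x0 + w" and L = 1]) simp
  have "absolutely_continuous_fun_on {-\<tau>..T} x"
    unfolding absolutely_continuous_fun_on_def
  proof (intro allI impI)
    fix e :: real assume "e > 0"
    with ac obtain \<delta> where "\<delta> > 0" and \<delta>: "\<forall>(N::nat) a b. (\<forall>i<N. a i \<le> b i \<and> {a i..b i} \<subseteq> {-\<tau>..T}) \<longrightarrow>
        disjoint_family_on (\<lambda>i. {a i<..<b i}) {..<N} \<longrightarrow> (\<Sum>i<N. b i - a i) < \<delta> \<longrightarrow>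
        (\<Sum>i<N. norm ((x0 + integral {-\<tau>..b i} g) - (x0 + integral {-\<tau>..a i} g))) < e"
      unfolding absolutely_continuous_fun_on_def by blast
    show "\<exists>\<delta>>0. \<forall>(N::nat) a b. (\<forall>i<N. a i \<le> b i \<and> {a i..b i} \<subseteq> {-\<tau>..T}) \<longrightarrow>
        disjoint_family_on (\<lambda>i. {a i<..<b i}) {..<N} \<longrightarrow> (\<Sum>i<N. b i - a i) < \<delta> \<longrightarrow>
        (\<Sum>i<N. norm (x (b i) - x (a i))) < e"
    proof (intro exI[of _ \<delta>] conjI allI impI \<open>\<delta> > 0\<close>)
      fix N :: nat and a b :: "nat \<Rightarrow> real"
      assume ab: "\<forall>i<N. a i \<le> b i \<and> {a i..b i} \<subseteq> {-\<tau>..T}"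
        and "disjoint_family_on (\<lambda>i. {a i<..<b i}) {..<N}" "(\<Sum>i<N. b i - a i) < \<delta>"
      with \<delta> have "(\<Sum>i<N. norm ((x0 + integral {-\<tau>..b i} g) - (x0 + integral {-\<tau>..a i} g))) < e"
        by blast
      moreover have "x (b i) - x (a i) = (x0 + integral {-\<tau>..b i} g) - (x0 + integral {-\<tau>..a i} g)" if "i < N" for i
      proof -
        have "a i \<le> b i" "{a i..b i} \<subseteq> {-\<tau>..T}" using ab that by auto
        then have "a i \<in> {-\<tau>..T}" "b i \<in> {-\<tau>..T}" by auto
        then show ?thesis using x_eq by metis
      qed
      ultimately show "(\<Sum>i<N. norm (x (b i) - x (a i))) < e" by simp
    qed
  qed
  moreover obtain N where N: "negligible N" "\<And>t. t \<in> {-\<tau>..T} - N \<Longrightarrow>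
    ((\<lambda>u. integral {-\<tau>..u} g) has_vector_derivative g t) (at t within {-\<tau>..T})"
    using has_vector_derivative_indefinite_integral_AE[OF gi] by blast
  have "AE t in lebesgue_on {0..T}.
        (x has_vector_derivative f t (x t) (x (t - \<tau>))) (at t within {-\<tau>..T})"
  proof (subst AE_restrict_space_iff)
    have "(x has_vector_derivative f t (x t) (x (t - \<tau>))) (at t within {-\<tau>..T})" if t: "t \<in> {0..T}" "t \<notin> N" for t
    proof (rule has_vector_derivative_transform)
      show t': "t \<in> {-\<tau>..T}" using t tau_pos by auto
      show "x s = x0 + integral {-\<tau>..s} g" if "s \<in> {-\<tau>..T}" for s by (rule x_eq[OF that])
      have "((\<lambda>u. x0 + integral {-\<tau>..u} g) has_vector_derivative 0 + g t) (at t within {-\<tau>..T})"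
        using N(2)[of t] t t' by (intro has_vector_derivative_add has_vector_derivative_const) auto
      then show "((\<lambda>u. x0 + integral {-\<tau>..u} g) has_vector_derivative f t (x t) (x (t - \<tau>))) (at t within {-\<tau>..T})"
        using t by (simp add: g_def)
    qed
    then show "AE t in lebesgue. t \<in> {0..T} \<longrightarrow>
        (x has_vector_derivative f t (x t) (x (t - \<tau>))) (at t within {-\<tau>..T})"
      by (intro AE_I'[of N]) (use N(1) in \<open>auto simp: negligible_iff_null_sets\<close>)
  qed simp
  ultimately show "dde_solution n \<tau> x0 f x"
    using init unfolding dde_solution_def T_def by blast
qed

section \<open>Bounds and Hoelder estimates on each step\<close>

text \<open>The constants \<open>dde_bound\<close> use the Bochner integral of the absolute value,
  Gronwall the Henstock--Kurzweil integral; for nonnegative \<open>K\<close> they coincide.\<close>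

lemma Lp_norm_1_K:
  assumes "0 \<le> a" "b \<le> T"
  shows "Lp_norm 1 {a..b} K = integral {a..b} K"
proof -
  have "K absolutely_integrable_on {a..b}"
    using K_nonneg assms integrable_subinterval_real[OF K_integrable, of a b]
    by (intro nonnegative_absolutely_integrable_1) auto
  then have "integrable (lebesgue_on {a..b}) K"
    by (rule absolutely_integrable_imp_integrable) simp
  then have "(LINT t|lebesgue_on {a..b}. K t) = integral {a..b} K"
    by (rule lebesgue_integral_eq_integral) simp
  moreover have "(LINT t|lebesgue_on {a..b}. \<bar>K t\<bar>) = (LINT t|lebesgue_on {a..b}. K t)"
    using K_nonneg assms by (intro Bochner_Integration.integral_cong) auto
  ultimately show ?thesis by (simp add: Lp_norm_1)
qed

lemma dde_bound_nonneg: "0 \<le> dde_bound \<tau> x0 K j"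
  by (induction j) (auto simp: Lp_norm_1 intro!: mult_nonneg_nonneg add_nonneg_nonneg)

lemma self_solution_increment:
  assumes sol: "solves_with_delay x x T" and "0 \<le> s" "s \<le> t" "t \<le> T"
  shows "x t = x s + integral {s..t} (\<lambda>r. f r (x r) (x (r - \<tau>)))"
proof -
  have cont: "continuous_on {-\<tau>..T} x" using sol by (simp add: solves_with_delay_def)
  then have "continuous_on {0..T} x" using tau_pos by (auto elim: continuous_on_subset)
  then have "(\<lambda>r. f r (x r) (x (r - \<tau>))) integrable_on {0..t}"
    using cont assms by (intro rhs_integrable) auto
  from Henstock_Kurzweil_Integration.integral_combine[OF assms(2,3) this]
  show ?thesis
    using sol assms by (simp add: solves_with_delay_def flip: add.assoc)
qed

text \<open>In the shifted indexing, \<open>j = 0\<close> is the history interval, so the induction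
  starts from \<open>x = x0\<close>. On a further step the previous bound \<open>B\<close> controls
  both the delayed argument and the initial value, and the growth bound becomes linear with kernel
  \<open>K s * (1 + B)\<close>.\<close>

lemma self_solution_norm_le:
  assumes sol: "solves_with_delay x x T" and "j \<le> Suc n" "t \<in> {real j * \<tau> - \<tau>..real j * \<tau>}"
  shows "norm (x t) \<le> dde_bound \<tau> x0 K j"
  using assms(2,3)
proof (induction j arbitrary: t)
  case 0
  then show ?case using sol by (simp add: solves_with_delay_def)
next
  case (Suc j)
  define a b where "a = real j * \<tau>" and "b = (real j + 1) * \<tau>"
  define B where "B = dde_bound \<tau> x0 K j"
  have ab: "0 \<le> a" "a \<le> b" "b \<le> T" "b - \<tau> = a"
    using tau_pos mult_tau_le_T[OF Suc.prems(1)] by (auto simp: a_def b_def algebra_simps)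
  have t: "t \<in> {a..b}" using Suc.prems(2) by (simp add: a_def b_def algebra_simps)
  have B: "0 \<le> B" "norm (x a) \<le> B" "\<And>s. s \<in> {a..b} \<Longrightarrow> norm (x (s - \<tau>)) \<le> B"
    using Suc.IH Suc.prems(1) dde_bound_nonneg ab tau_pos unfolding B_def a_def b_def by auto
  have cont: "continuous_on {-\<tau>..T} x" using sol by (simp add: solves_with_delay_def)
  then have cont0: "continuous_on {0..T} x" using tau_pos by (auto elim: continuous_on_subset)
  define k where "k = integral {a..b} K"
  have Kab: "K integrable_on {a..b}" using integrable_subinterval_real[OF K_integrable, of a b] ab by auto
  have "0 \<le> k" unfolding k_def using K_nonneg ab by (intro integral_nonneg Kab) auto
  have int: "integral {a..b} (\<lambda>s. K s * (1 + B)) = (1 + B) * k"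
    unfolding k_def using Kab by (simp add: mult.commute)
  have "norm (x t) \<le> (norm (x a) + integral {a..b} (\<lambda>s. K s * (1 + B))) * exp (integral {a..b} (\<lambda>s. K s * (1 + B)))"
  proof (rule norm_le_if_linear_growth[OF _ _ _ _ _ _ t])
    show "continuous_on {a..b} x" using cont0 ab by (auto elim: continuous_on_subset)
    show "(\<lambda>r. f r (x r) (x (r - \<tau>))) integrable_on {a..b}"
      using cont0 cont ab by (intro rhs_integrable)
    show "x s = x a + integral {a..s} (\<lambda>r. f r (x r) (x (r - \<tau>)))" if "s \<in> {a..b}" for s
      using that ab by (intro self_solution_increment sol) auto
    show "(\<lambda>s. K s * (1 + B)) integrable_on {a..b}" by (intro integrable_on_mult_left Kab)
    fix s assume s: "s \<in> {a..b}"
    then have sT: "s \<in> {0..T}" using ab by auto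
    show "0 \<le> K s * (1 + B)" using K_nonneg[OF sT] B by simp
    have "norm (f s (x s) (x (s - \<tau>))) \<le> K s * (1 + norm (x s)) * (1 + norm (x (s - \<tau>)))"
      by (rule A3[OF sT])
    also have "\<dots> \<le> K s * (1 + norm (x s)) * (1 + B)"
      using B(3)[OF s] K_nonneg[OF sT] by (intro mult_left_mono) auto
    finally show "norm (f s (x s) (x (s - \<tau>))) \<le> K s * (1 + B) * (1 + norm (x s))"
      by (simp add: ac_simps)
  qed
  also have "\<dots> = (norm (x a) + (1 + B) * k) * exp ((1 + B) * k)"
    by (simp only: int)
  \<comment> \<open>Estimating \<open>norm (x a)\<close> by \<open>1 + B\<close> instead of
    \<open>B\<close> lets \<open>1 + B\<close> be factored out; this is where the product form of
    the constants comes from.\<close>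
  also have "\<dots> \<le> (1 + B) * (1 + k) * exp ((1 + B) * k)"
    using B(2) by (intro mult_right_mono) (auto simp: algebra_simps)
  also have "\<dots> = dde_bound \<tau> x0 K (Suc j)"
    using Lp_norm_1_K[OF ab(1,3)] by (simp add: B_def k_def a_def b_def)
  finally show ?case .
qed

text \<open>On one step both \<open>x\<close> and its delayed value are bounded, so (A3) dominates
  the derivative by the constant \<open>C\<close> times \<open>K\<close>, and
  \<open>integral_le_Lp_norm\<close> measures the integral of \<open>K\<close>.\<close>

lemma self_solution_Holder:
  assumes sol: "solves_with_delay x x T" and p: "1 < p" "Lp_on p {0..T} K" and "j \<le> n"
    and st: "real j * \<tau> \<le> s" "s \<le> t" "t \<le> (real j + 1) * \<tau>"
  shows "norm (x t - x s) \<le> (1 + dde_bound \<tau> x0 K j) * (1 + dde_bound \<tau> x0 K (Suc j)) *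
      Lp_norm p {real j * \<tau>..(real j + 1) * \<tau>} K * (t - s) powr (1 - real_of_ereal (1 / p))"
proof -
  define a b where "a = real j * \<tau>" and "b = (real j + 1) * \<tau>"
  define C where "C = (1 + dde_bound \<tau> x0 K j) * (1 + dde_bound \<tau> x0 K (Suc j))"
  have ab: "0 \<le> a" "a \<le> s" "t \<le> b" "b \<le> T"
    using tau_pos mult_tau_le_T[of "Suc j"] \<open>j \<le> n\<close> st by (auto simp: a_def b_def algebra_simps)
  have "0 \<le> C"
    unfolding C_def using dde_bound_nonneg[of j] dde_bound_nonneg[of "Suc j"] by (simp del: dde_bound.simps)
  have cont: "continuous_on {-\<tau>..T} x" using sol by (simp add: solves_with_delay_def)
  then have cont0: "continuous_on {0..T} x" using tau_pos by (auto elim: continuous_on_subset)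
  have Kst: "K integrable_on {s..t}" and Kab: "K integrable_on {a..b}"
    using integrable_subinterval_real[OF K_integrable] ab by auto
  have "x t - x s = integral {s..t} (\<lambda>r. f r (x r) (x (r - \<tau>)))"
    using self_solution_increment[OF sol, of s t] ab st by simp
  also have "norm \<dots> \<le> integral {s..t} (\<lambda>r. C * K r)"
  proof (rule integral_norm_bound_integral)
    show "(\<lambda>r. f r (x r) (x (r - \<tau>))) integrable_on {s..t}"
      using cont0 cont ab by (intro rhs_integrable) auto
    show "(\<lambda>r. C * K r) integrable_on {s..t}" by (intro integrable_on_mult_right Kst)
    fix r assume "r \<in> {s..t}"
    then have r: "r \<in> {a..b}" "r \<in> {0..T}" using ab by auto
    have "norm (x r) \<le> dde_bound \<tau> x0 K (Suc j)" "norm (x (r - \<tau>)) \<le> dde_bound \<tau> x0 K j"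
      using r(1) \<open>j \<le> n\<close> by (auto intro!: self_solution_norm_le[OF sol] simp: a_def b_def algebra_simps simp del: dde_bound.simps)
    then have "(1 + norm (x r)) * (1 + norm (x (r - \<tau>))) \<le> (1 + dde_bound \<tau> x0 K (Suc j)) * (1 + dde_bound \<tau> x0 K j)"
      using dde_bound_nonneg[of "Suc j"] by (intro mult_mono) auto
    then have "K r * ((1 + norm (x r)) * (1 + norm (x (r - \<tau>)))) \<le> K r * C"
      using K_nonneg[OF r(2)] unfolding C_def by (intro mult_left_mono) (auto simp: mult.commute)
    with A3[OF r(2), of "x r" "x (r - \<tau>)"]
    show "norm (f r (x r) (x (r - \<tau>))) \<le> C * K r" by (simp add: ac_simps)
  qed
  also have "\<dots> = C * integral {s..t} K" by simp
  also have "\<dots> \<le> C * (Lp_norm p {a..b} K * (t - s) powr (1 - real_of_ereal (1 / p)))"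
  proof (intro mult_left_mono \<open>0 \<le> C\<close> integral_le_Lp_norm)
    show "Lp_on p {a..b} K" by (rule Lp_on_subset[OF p(2)]) (use ab in auto)
  qed (use p Kab ab st K_nonneg in auto)
  finally show ?thesis by (simp add: C_def a_def b_def mult.assoc)
qed

end

theorem theorem3p1:
  fixes n :: nat and \<tau> :: real and x0 :: "real ^ 'd"
    and f :: "real \<Rightarrow> real ^ 'd \<Rightarrow> real ^ 'd \<Rightarrow> real ^ 'd"
    and K :: "real \<Rightarrow> real"
  assumes tau_pos: "\<tau> > 0"
    and A1: "\<And>t. t \<in> {0..(real n + 1) * \<tau>} \<Longrightarrow> continuous_on UNIV (\<lambda>(x, z). f t x z)"
    and A2: "\<And>x z. (\<lambda>t. f t x z) \<in> borel_measurable (restrict_space borel {0..(real n + 1) * \<tau>})"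
    and K_nonneg: "\<And>t. t \<in> {0..(real n + 1) * \<tau>} \<Longrightarrow> K t \<ge> 0"
    and K_L1: "Lp_on 1 {0..(real n + 1) * \<tau>} K"
    and A3: "\<And>t x z. t \<in> {0..(real n + 1) * \<tau>} \<Longrightarrow>
               norm (f t x z) \<le> K t * (1 + norm x) * (1 + norm z)"
    and A4: "\<And>U. compact U \<Longrightarrow>
               \<exists>L :: real \<Rightarrow> real.
                 (\<forall>t\<in>{0..(real n + 1) * \<tau>}. L t \<ge> 0) \<and>
                 Lp_on 1 {0..(real n + 1) * \<tau>} L \<and>
                 (\<forall>t\<in>{0..(real n + 1) * \<tau>}. \<forall>x1\<in>U. \<forall>x2\<in>U. \<forall>z.
                    norm (f t x1 z - f t x2 z) \<le> L t * (1 + norm z) * norm (x1 - x2))"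
  shows "\<exists>x. dde_solution n \<tau> x0 f x \<and>
           (\<forall>y. dde_solution n \<tau> x0 f y \<longrightarrow> (\<forall>t\<in>{-\<tau>..(real n + 1) * \<tau>}. y t = x t)) \<and>
           (\<forall>j\<le>n. (SUP t\<in>{0..\<tau>}. ereal (norm (x (t + real j * \<tau>))))
                    \<le> ereal (dde_bound \<tau> x0 K (Suc j))) \<and>
           (\<forall>p::ereal. 1 < p \<longrightarrow> Lp_on p {0..(real n + 1) * \<tau>} K \<longrightarrow>
              (\<forall>j\<le>n. \<forall>t\<in>{0..\<tau>}. \<forall>s\<in>{0..\<tau>}.
                 norm (x (t + real j * \<tau>) - x (s + real j * \<tau>))
                   \<le> (1 + dde_bound \<tau> x0 K j) * (1 + dde_bound \<tau> x0 K (Suc j)) *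
                     Lp_norm p {real j * \<tau>..(real j + 1) * \<tau>} K *
                     \<bar>t - s\<bar> powr (1 - real_of_ereal (1 / p))))"
proof -
  interpret delay_ode n \<tau> x0 f K "(real n + 1) * \<tau>"
    by unfold_locales (rule refl tau_pos A1 A2 K_nonneg K_L1 A3 A4 | assumption)+
  let ?T = "(real n + 1) * \<tau>"
  obtain x where x: "solves_with_delay x x ?T"
    using self_solution_exists by blast
  show ?thesis
  proof (intro exI[of _ x] conjI allI impI ballI)
    show "dde_solution n \<tau> x0 f x" using x by (simp only: dde_solution_iff)
    show "y t = x t" if "dde_solution n \<tau> x0 f y" "t \<in> {-\<tau>..?T}" for y t
      using that x by (intro self_solution_unique) (simp_all only: dde_solution_iff)
    show "(SUP t\<in>{0..\<tau>}. ereal (norm (x (t + real j * \<tau>)))) \<le> ereal (dde_bound \<tau> x0 K (Suc j))"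
      if "j \<le> n" for j
    proof (rule SUP_least)
      fix t assume "t \<in> {0..\<tau>}"
      then have "norm (x (t + real j * \<tau>)) \<le> dde_bound \<tau> x0 K (Suc j)"
        using that by (intro self_solution_norm_le[OF x]) (auto simp: algebra_simps)
      then show "ereal (norm (x (t + real j * \<tau>))) \<le> ereal (dde_bound \<tau> x0 K (Suc j))"
        by (simp only: ereal_less_eq)
    qed
    fix p :: ereal and j t s
    assume p: "1 < p" "Lp_on p {0..?T} K" "j \<le> n" and ts: "t \<in> {0..\<tau>}" "s \<in> {0..\<tau>}"
    \<comment> \<open>The ordered case, free of absolute values; the other order follows by
      exchanging \<open>s\<close> and \<open>t\<close>.\<close>
    have *: "norm (x (t + real j * \<tau>) - x (s + real j * \<tau>))
        \<le> (1 + dde_bound \<tau> x0 K j) * (1 + dde_bound \<tau> x0 K (Suc j)) *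
          Lp_norm p {real j * \<tau>..(real j + 1) * \<tau>} K * (t - s) powr (1 - real_of_ereal (1 / p))"
      if "s \<le> t" "t \<in> {0..\<tau>}" "s \<in> {0..\<tau>}" for s t
    proof -
      have "(t + real j * \<tau>) - (s + real j * \<tau>) = t - s" by simp
      then show ?thesis
        using self_solution_Holder[OF x p, of "s + real j * \<tau>" "t + real j * \<tau>"] that
        by (simp only:) (simp add: algebra_simps)
    qed
    show "norm (x (t + real j * \<tau>) - x (s + real j * \<tau>))
        \<le> (1 + dde_bound \<tau> x0 K j) * (1 + dde_bound \<tau> x0 K (Suc j)) *
          Lp_norm p {real j * \<tau>..(real j + 1) * \<tau>} K * \<bar>t - s\<bar> powr (1 - real_of_ereal (1 / p))"
    proof (cases "s \<le> t")
      case True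
      then show ?thesis using *[OF True ts] by (simp only: abs_of_nonneg diff_ge_0_iff_ge)
    next
      case False
      then have "t \<le> s" by simp
      from *[OF this ts(2,1)] \<open>t \<le> s\<close> show ?thesis
        by (simp only: norm_minus_commute[of "x (t + _)"] abs_minus_commute[of t s] abs_of_nonneg diff_ge_0_iff_ge)
    qed
  qed
qed

end
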